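(* For any topological group $G$: (1) $K(G)$ is a closed left $G$-invariant subalgebra of $RUC(G)$. (2) The algebra $K(G)$ is point-universal. (3) $Asp(G)\subset K(G)$. (4) $K(G)=Asp(G)=Asp_s(G)$ if $G$ is separable.
   Context: $RUC(G)$ is the Banach algebra (sup norm) of bounded $f:G\to\mathbb R$ such that for every $\varepsilon>0$ there is a neighborhood $V$ of $e$ with $\sup_{g\in G}|f(vg)-f(g)|<\varepsilon$ for all $v\in V$. Left translation: ${}_gf(x)=f(gx)$; subalgebras contain the constants, "closed" means uniformly closed, and "left $G$-invariant" means invariant under all $f\mapsto{}_gf$. Veech functions $K(G)$: for a subgroup $H<G$ and $f\in RUC(G)$ let $X_{f|_H}\subset[-\|f\|,\|f\|]^H$ be the pointwise closure of the set of right translates $\{h'\mapsto f(h'h):h\in H\}$ of $f|_H$; its elements lie in $RUC(H)$. $K(G)$ is the set of $f\in RUC(G)$ such that for every countable (equivalently, separable) subgroup $H<G$ the set $X_{f|_H}$ is separable in the norm of $RUC(H)$. Asplund functions: a compact $G$-system is a compact Hausdorff space $Y$ with a continuous left $G$-action. For $F\in C(Y)$ and $H<G$ put $\rho_{H,F}(y,y')=\sup_{h\in H}|F(hy)-F(hy')|$. $F$ is an Asplund function if $(Y,\rho_{H,F})$ is separable for every countable subgroup $H<G$, and s-Asplund if $(Y,\rho_{G,F})$ is separable. $Asp(G)$ (resp. $Asp_s(G)$) is the set of $f\in RUC(G)$ for which there are a compact $G$-system $Y$, a point $y_0\in Y$ with dense orbit and an Asplund (resp. s-Asplund) function $F\in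 C(Y)$ with $f(g)=F(gy_0)$ for all $g\in G$. Point-universality: for a closed left $G$-invariant subalgebra $\mathcal A\subset RUC(G)$, its Gelfand space $|\mathcal A|$ (multiplicative functionals, weak$^*$ topology) is a compact $G$-system under $(g\varphi)(f)=\varphi({}_gf)$, with distinguished transitive point $\mathrm{eva}_e:f\mapsto f(e)$. $\mathcal A$ is point-universal if for every $x\in|\mathcal A|$ there is a continuous $G$-equivariant map $\pi_x:|\mathcal A|\to\overline{Gx}$ with $\pi_x(\mathrm{eva}_e)=x$. *)

theory Defs
  imports "HOL-Analysis.Analysis"
begin

text \<open>
  A topological group is a type of class \<^class>\<open>topological_group_add\<close>. This class is written
  additively but is neither commutative nor Hausdorff: \<open>g + h\<close> stands for the product \<open>gh\<close>,
  \<open>0\<close> for the neutral element \<open>e\<close> and \<open>- g\<close> for the inverse.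
\<close>

definition subgroup_set :: "'g::group_add set \<Rightarrow> bool" where
  "subgroup_set H \<longleftrightarrow> 0 \<in> H \<and> (\<forall>x\<in>H. \<forall>y\<in>H. x + y \<in> H) \<and> (\<forall>x\<in>H. - x \<in> H)"

definition sup_norm :: "'a set \<Rightarrow> ('a \<Rightarrow> real) \<Rightarrow> real" where
  "sup_norm S u = (SUP s\<in>S. \<bar>u s\<bar>)"

definition separable_wrt :: "('a \<Rightarrow> 'a \<Rightarrow> real) \<Rightarrow> 'a set \<Rightarrow> bool" where
  "separable_wrt d S \<longleftrightarrow> (\<exists>D\<subseteq>S. countable D \<and> (\<forall>x\<in>S. \<forall>\<epsilon>>0. \<exists>y\<in>D. d x y < \<epsilon>))"

definition RUC :: "('g::topological_group_add \<Rightarrow> real) set" where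
  "RUC = {f. bounded (range f) \<and>
             (\<forall>\<epsilon>>0. \<forall>\<^sub>F v in nhds 0. sup_norm UNIV (\<lambda>g. f (v + g) - f g) < \<epsilon>)}"

definition left_translate :: "'g::plus \<Rightarrow> ('g \<Rightarrow> real) \<Rightarrow> 'g \<Rightarrow> real" where
  "left_translate g f = (\<lambda>x. f (g + x))"

text \<open>Closure under scalar multiples follows from constants and products.\<close>

definition RUC_subalgebra :: "('g::topological_group_add \<Rightarrow> real) set \<Rightarrow> bool" where
  "RUC_subalgebra A \<longleftrightarrow> A \<subseteq> RUC \<and> (\<forall>c. (\<lambda>_. c) \<in> A) \<and>
     (\<forall>f\<in>A. \<forall>h\<in>A. (\<lambda>x. f x + h x) \<in> A \<and> (\<lambda>x. f x * h x) \<in> A)"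

definition uniformly_closed :: "('a \<Rightarrow> real) set \<Rightarrow> bool" where
  "uniformly_closed A \<longleftrightarrow>
     (\<forall>F f. (\<forall>n. F n \<in> A) \<longrightarrow> uniform_limit UNIV F f sequentially \<longrightarrow> f \<in> A)"

definition left_invariant :: "('g::plus \<Rightarrow> real) set \<Rightarrow> bool" where
  "left_invariant A \<longleftrightarrow> (\<forall>f\<in>A. \<forall>g. left_translate g f \<in> A)"


subsection \<open>Veech functions\<close>

text \<open>Functions on \<open>H\<close> are represented by the extensional functions, i.e. those with value
  \<^const>\<open>undefined\<close> outside \<open>H\<close>. The closure in \<open>\<real>\<^sup>H\<close> automatically lies in the closed
  cube \<open>[-\<parallel>f\<parallel>, \<parallel>f\<parallel>]\<^sup>H\<close>.\<close>

definition translate_hull :: "'g::topological_group_add set \<Rightarrow> ('g \<Rightarrow> real) \<Rightarrow> ('g \<Rightarrow> real) set" where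
  "translate_hull H f =
     product_topology (\<lambda>_. euclideanreal) H closure_of ((\<lambda>h. restrict (\<lambda>h'. f (h' + h)) H) ` H)"

definition Veech :: "('g::topological_group_add \<Rightarrow> real) set" where
  "Veech = {f \<in> RUC. \<forall>H. subgroup_set H \<and> countable H \<longrightarrow>
              separable_wrt (\<lambda>u w. sup_norm H (\<lambda>h. u h - w h)) (translate_hull H f)}"


subsection \<open>Asplund functions\<close>

definition compact_G_system ::
    "'y topology \<Rightarrow> ('g::topological_group_add \<Rightarrow> 'y \<Rightarrow> 'y) \<Rightarrow> bool" where
  "compact_G_system Y act \<longleftrightarrow> compact_space Y \<and> Hausdorff_space Y \<and>
     continuous_map (prod_topology euclidean Y) Y (\<lambda>(g, y). act g y) \<and>
     (\<forall>y\<in>topspace Y. act 0 y = y \<and> (\<forall>g h. act (g + h) y = act g (act h y)))"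

definition orbit_pseudometric ::
    "('g \<Rightarrow> 'y \<Rightarrow> 'y) \<Rightarrow> 'g set \<Rightarrow> ('y \<Rightarrow> real) \<Rightarrow> 'y \<Rightarrow> 'y \<Rightarrow> real" where
  "orbit_pseudometric act H F y y' = sup_norm H (\<lambda>h. F (act h y) - F (act h y'))"

definition Asplund_function ::
    "'y topology \<Rightarrow> ('g::topological_group_add \<Rightarrow> 'y \<Rightarrow> 'y) \<Rightarrow> ('y \<Rightarrow> real) \<Rightarrow> bool" where
  "Asplund_function Y act F \<longleftrightarrow> continuous_map Y euclideanreal F \<and>
     (\<forall>H. subgroup_set H \<and> countable H \<longrightarrow>
        separable_wrt (orbit_pseudometric act H F) (topspace Y))"

definition s_Asplund_function ::
    "'y topology \<Rightarrow> ('g::topological_group_add \<Rightarrow> 'y \<Rightarrow> 'y) \<Rightarrow> ('y \<Rightarrow> real) \<Rightarrow> bool" where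
  "s_Asplund_function Y act F \<longleftrightarrow> continuous_map Y euclideanreal F \<and>
     separable_wrt (orbit_pseudometric act UNIV F) (topspace Y)"

definition dense_orbit ::
    "'y topology \<Rightarrow> ('g::topological_group_add \<Rightarrow> 'y \<Rightarrow> 'y) \<Rightarrow> 'y \<Rightarrow> bool" where
  "dense_orbit Y act y0 \<longleftrightarrow> y0 \<in> topspace Y \<and> Y closure_of (range (\<lambda>g. act g y0)) = topspace Y"

definition Asp_on :: "'y itself \<Rightarrow> ('g::topological_group_add \<Rightarrow> real) set" where
  "Asp_on _ = {f \<in> RUC. \<exists>(Y :: 'y topology) act y0 F. compact_G_system Y act \<and>
      dense_orbit Y act y0 \<and> Asplund_function Y act F \<and> (\<forall>g. f g = F (act g y0))}"

definition Asp_s_on :: "'y itself \<Rightarrow> ('g::topological_group_add \<Rightarrow> real) set" where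
  "Asp_s_on _ = {f \<in> RUC. \<exists>(Y :: 'y topology) act y0 F. compact_G_system Y act \<and>
      dense_orbit Y act y0 \<and> s_Asplund_function Y act F \<and> (\<forall>g. f g = F (act g y0))}"

text \<open>
  HOL cannot quantify over all compact systems, whatever the type of their points. A compact
  Hausdorff space with a dense \<open>G\<close>-orbit injects into the power set of the power set of \<open>G\<close>,
  so systems with points in that type suffice: this is \<open>Asp_on_subset_Asp\<close> and
  \<open>Asp_s_on_subset_Asp_s\<close> below.
\<close>

definition Asp :: "('g::topological_group_add \<Rightarrow> real) set" where
  "Asp = Asp_on TYPE('g set set)"

definition Asp_s :: "('g::topological_group_add \<Rightarrow> real) set" where
  "Asp_s = Asp_s_on TYPE('g set set)"

lemma transport_topology:
  fixes Y :: "'y topology" and e :: "'y \<Rightarrow> 'z"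
  assumes "inj_on e (topspace Y)"
  obtains Z d where "homeomorphic_maps Y Z e d"
proof -
  define S where "S = topspace Y"
  define d where "d = inv_into S e"
  define Z where "Z = pullback_topology (e ` S) d Y"
  have de: "d (e y) = y" if "y \<in> S" for y
    using assms that by (simp add: d_def S_def)
  have Z: "topspace Z = e ` S"
    by (auto simp: Z_def topspace_pullback_topology de) (simp add: S_def)
  have "continuous_map Z Y d"
    unfolding Z_def using continuous_map_pullback[of Y Y id "e ` S" d] by simp
  moreover have "continuous_map Y Z e"
    unfolding Z_def
  proof (rule continuous_map_pullback')
    show "continuous_map Y Y (d \<circ> e)"
      by (rule continuous_map_eq[OF continuous_map_id]) (simp add: de S_def)
    show "topspace Y \<subseteq> e -` (e ` S)" by (auto simp: S_def)
  qed
  ultimately have "homeomorphic_maps Y Z e d"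
    unfolding homeomorphic_maps_def using de Z by (auto simp: S_def)
  then show thesis by (rule that)
qed

lemma dense_orbit_injection:
  fixes act :: "'g::topological_group_add \<Rightarrow> 'y \<Rightarrow> 'y"
  assumes sys: "compact_G_system Y act" and y0: "dense_orbit Y act y0"
  shows "inj_on (\<lambda>y. {A :: 'g set. y \<in> Y closure_of ((\<lambda>g. act g y0) ` A)}) (topspace Y)"
proof (rule inj_onI, rule ccontr)
  fix y z
  assume y: "y \<in> topspace Y" and z: "z \<in> topspace Y" and "y \<noteq> z"
    and eq: "{A. y \<in> Y closure_of ((\<lambda>g. act g y0) ` A)} =
             {A. z \<in> Y closure_of ((\<lambda>g. act g y0) ` A)}"
  then obtain U V where UV: "openin Y U" "openin Y V" "y \<in> U" "z \<in> V" "disjnt U V"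
    using sys unfolding compact_G_system_def Hausdorff_space_def by metis
  define A where "A = {g. act g y0 \<in> U}"
  have "y \<in> Y closure_of ((\<lambda>g. act g y0) ` A)"
    unfolding in_closure_of
  proof (intro conjI allI impI y)
    fix T assume T: "y \<in> T \<and> openin Y T"
    then have "openin Y (T \<inter> U)" "y \<in> T \<inter> U" using UV by auto
    moreover have "y \<in> Y closure_of (range (\<lambda>g. act g y0))"
      using y0 y by (simp add: dense_orbit_def)
    ultimately obtain g where "act g y0 \<in> T \<inter> U"
      unfolding in_closure_of by blast
    then show "\<exists>w. w \<in> (\<lambda>g. act g y0) ` A \<and> w \<in> T" by (auto simp: A_def)
  qed
  then have "z \<in> Y closure_of ((\<lambda>g. act g y0) ` A)" using eq by blast
  then show False
    using UV unfolding in_closure_of A_def disjnt_def by blast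
qed

lemma transport_system:
  fixes act :: "'g::topological_group_add \<Rightarrow> 'y \<Rightarrow> 'y"
  assumes hom: "homeomorphic_maps Y Z e d"
    and sys: "compact_G_system Y act" and y0: "dense_orbit Y act y0"
    and F: "continuous_map Y euclideanreal F"
  defines "act' \<equiv> \<lambda>g z. e (act g (d z))"
  shows "compact_G_system Z act'" "dense_orbit Z act' (e y0)"
    "continuous_map Z euclideanreal (F \<circ> d)" "(F \<circ> d) (act' g (e y0)) = F (act g y0)"
    "separable_wrt (orbit_pseudometric act H F) (topspace Y) \<Longrightarrow>
       separable_wrt (orbit_pseudometric act' H (F \<circ> d)) (topspace Z)"
proof -
  have ce: "continuous_map Y Z e" and cd: "continuous_map Z Y d"
    and de: "\<And>y. y \<in> topspace Y \<Longrightarrow> d (e y) = y" and ed: "\<And>z. z \<in> topspace Z \<Longrightarrow> e (d z) = z"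
    using hom unfolding homeomorphic_maps_def by auto
  have eY: "\<And>y. y \<in> topspace Y \<Longrightarrow> e y \<in> topspace Z"
    and dZ: "\<And>z. z \<in> topspace Z \<Longrightarrow> d z \<in> topspace Y"
    using ce cd by (auto simp: continuous_map_def)
  have cact: "continuous_map (prod_topology euclidean Y) Y (\<lambda>(g, y). act g y)"
    using sys by (simp add: compact_G_system_def)
  have actY: "act g y \<in> topspace Y" if "y \<in> topspace Y" for g y
    using cact that by (force simp: continuous_map_def)
  have y0Y: "y0 \<in> topspace Y" using y0 by (simp add: dense_orbit_def)
  have hs: "Y homeomorphic_space Z" using hom by (auto simp: homeomorphic_space_def)
  have map: "homeomorphic_map Y Z e" using hom by (auto simp: homeomorphic_map_maps)
  show "compact_G_system Z act'"
    unfolding compact_G_system_def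
  proof (intro conjI ballI allI)
    show "compact_space Z" "Hausdorff_space Z"
      using sys hs homeomorphic_compact_space homeomorphic_Hausdorff_space
      unfolding compact_G_system_def by blast+
    have "continuous_map (prod_topology euclidean Z) (prod_topology euclidean Y)
            (\<lambda>p. (fst p, d (snd p)))"
      using continuous_map_compose[OF continuous_map_snd cd]
      by (intro continuous_map_pairedI) (auto simp: o_def continuous_map_fst)
    from continuous_map_compose[OF continuous_map_compose[OF this cact] ce]
    show "continuous_map (prod_topology euclidean Z) Z (\<lambda>(g, y). act' g y)"
      by (simp add: o_def act'_def case_prod_unfold)
  next
    fix z assume z: "z \<in> topspace Z"
    show "act' 0 z = z"
      using sys z by (simp add: act'_def compact_G_system_def dZ ed)
    fix g h
    show "act' (g + h) z = act' g (act' h z)"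
      using sys z by (simp add: act'_def compact_G_system_def dZ de actY)
  qed
  show "dense_orbit Z act' (e y0)"
  proof -
    have "range (\<lambda>g. act g y0) \<subseteq> topspace Y" using actY y0Y by auto
    from homeomorphic_map_closure_of[OF map this]
    have "Z closure_of (e ` range (\<lambda>g. act g y0)) = e ` topspace Y"
      using y0 by (simp add: dense_orbit_def)
    also have "e ` topspace Y = topspace Z"
      using map homeomorphic_imp_surjective_map by blast
    finally show ?thesis
      using y0Y by (simp add: dense_orbit_def act'_def de eY image_image)
  qed
  show "continuous_map Z euclideanreal (F \<circ> d)"
    by (rule continuous_map_compose[OF cd F])
  show "(F \<circ> d) (act' g (e y0)) = F (act g y0)"
    by (simp add: act'_def de actY y0Y)
  assume "separable_wrt (orbit_pseudometric act H F) (topspace Y)"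
  then obtain D where D: "D \<subseteq> topspace Y" "countable D"
    "\<forall>x\<in>topspace Y. \<forall>\<epsilon>>0. \<exists>y\<in>D. orbit_pseudometric act H F x y < \<epsilon>"
    unfolding separable_wrt_def by blast
  have rho: "orbit_pseudometric act' H (F \<circ> d) z (e y) = orbit_pseudometric act H F (d z) y"
    if "z \<in> topspace Z" "y \<in> topspace Y" for z y
    using that by (simp add: orbit_pseudometric_def act'_def de actY dZ)
  show "separable_wrt (orbit_pseudometric act' H (F \<circ> d)) (topspace Z)"
    unfolding separable_wrt_def
  proof (intro exI[of _ "e ` D"] conjI ballI allI impI)
    show "e ` D \<subseteq> topspace Z" using D eY by auto
    show "countable (e ` D)" using D by simp
    fix z and \<epsilon> :: real assume z: "z \<in> topspace Z" and "\<epsilon> > 0"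
    then obtain y where "y \<in> D" "orbit_pseudometric act H F (d z) y < \<epsilon>"
      using D dZ by blast
    then show "\<exists>w\<in>e ` D. orbit_pseudometric act' H (F \<circ> d) z w < \<epsilon>"
      using D z rho by (intro bexI[of _ "e y"]) auto
  qed
qed

lemma Asp_on_subset_Asp: "Asp_on TYPE('y) \<subseteq> (Asp :: ('g::topological_group_add \<Rightarrow> real) set)"
proof
  fix f :: "'g \<Rightarrow> real" assume "f \<in> Asp_on TYPE('y)"
  then obtain Y :: "'y topology" and act :: "'g \<Rightarrow> 'y \<Rightarrow> 'y" and y0 F where
    f: "f \<in> RUC" and sys: "compact_G_system Y act" and y0: "dense_orbit Y act y0"
    and F: "Asplund_function Y act F" and fF: "\<forall>g. f g = F (act g y0)"
    unfolding Asp_on_def by blast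
  from dense_orbit_injection[OF sys y0] obtain Z :: "'g set set topology" and e d where
    hom: "homeomorphic_maps Y Z e d" by (rule transport_topology)
  have cF: "continuous_map Y euclideanreal F" using F by (simp add: Asplund_function_def)
  note t = transport_system[OF hom sys y0 cF]
  have "Asplund_function Z (\<lambda>g z. e (act g (d z))) (F \<circ> d)"
    using F t(3,5) by (simp add: Asplund_function_def)
  with f fF t(1,2,4) show "f \<in> Asp"
    unfolding Asp_def Asp_on_def by (smt (verit) mem_Collect_eq)
qed

lemma Asp_s_on_subset_Asp_s:
  "Asp_s_on TYPE('y) \<subseteq> (Asp_s :: ('g::topological_group_add \<Rightarrow> real) set)"
proof
  fix f :: "'g \<Rightarrow> real" assume "f \<in> Asp_s_on TYPE('y)"
  then obtain Y :: "'y topology" and act :: "'g \<Rightarrow> 'y \<Rightarrow> 'y" and y0 F where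
    f: "f \<in> RUC" and sys: "compact_G_system Y act" and y0: "dense_orbit Y act y0"
    and F: "s_Asplund_function Y act F" and fF: "\<forall>g. f g = F (act g y0)"
    unfolding Asp_s_on_def by blast
  from dense_orbit_injection[OF sys y0] obtain Z :: "'g set set topology" and e d where
    hom: "homeomorphic_maps Y Z e d" by (rule transport_topology)
  have cF: "continuous_map Y euclideanreal F" using F by (simp add: s_Asplund_function_def)
  note t = transport_system[OF hom sys y0 cF]
  have "s_Asplund_function Z (\<lambda>g z. e (act g (d z))) (F \<circ> d)"
    using F t(3,5) by (simp add: s_Asplund_function_def)
  with f fF t(1,2,4) show "f \<in> Asp_s"
    unfolding Asp_s_def Asp_s_on_def by (smt (verit) mem_Collect_eq)
qed


subsection \<open>Point-universality\<close>

text \<open>Functionals on \<open>A\<close> are represented by extensional functions with domain \<open>A\<close>.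
  On a uniformly closed subalgebra, multiplicative functionals are automatically bounded.\<close>

definition Gelfand_space :: "('g \<Rightarrow> real) set \<Rightarrow> (('g \<Rightarrow> real) \<Rightarrow> real) set" where
  "Gelfand_space A = {\<phi> \<in> extensional A.
     (\<forall>f\<in>A. \<forall>h\<in>A. \<phi> (\<lambda>x. f x + h x) = \<phi> f + \<phi> h \<and> \<phi> (\<lambda>x. f x * h x) = \<phi> f * \<phi> h) \<and>
     (\<forall>c. \<forall>f\<in>A. \<phi> (\<lambda>x. c * f x) = c * \<phi> f) \<and>
     (\<exists>f\<in>A. \<phi> f \<noteq> 0)}"

definition Gelfand_topology :: "('g \<Rightarrow> real) set \<Rightarrow> (('g \<Rightarrow> real) \<Rightarrow> real) topology" where
  "Gelfand_topology A = subtopology (product_topology (\<lambda>_. euclideanreal) A) (Gelfand_space A)"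

definition Gelfand_act ::
    "('g::plus \<Rightarrow> real) set \<Rightarrow> 'g \<Rightarrow> (('g \<Rightarrow> real) \<Rightarrow> real) \<Rightarrow> ('g \<Rightarrow> real) \<Rightarrow> real" where
  "Gelfand_act A g \<phi> = restrict (\<lambda>f. \<phi> (left_translate g f)) A"

definition eva_e :: "('g::zero \<Rightarrow> real) set \<Rightarrow> ('g \<Rightarrow> real) \<Rightarrow> real" where
  "eva_e A = restrict (\<lambda>f. f 0) A"

text \<open>Meant for uniformly closed left invariant subalgebras of \<open>RUC\<close>.\<close>

definition point_universal :: "('g::topological_group_add \<Rightarrow> real) set \<Rightarrow> bool" where
  "point_universal A \<longleftrightarrow> (\<forall>x\<in>Gelfand_space A. \<exists>\<pi>.
     continuous_map (Gelfand_topology A)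
       (subtopology (Gelfand_topology A)
          (Gelfand_topology A closure_of (range (\<lambda>g. Gelfand_act A g x)))) \<pi> \<and>
     (\<forall>g. \<forall>\<phi>\<in>Gelfand_space A. \<pi> (Gelfand_act A g \<phi>) = Gelfand_act A g (\<pi> \<phi>)) \<and>
     \<pi> (eva_e A) = x)"

end

theory Submission
  imports Defs
begin

text \<open>
  Everything rests on one compactness principle, \<open>closure_subset_compact_image\<close>: if a continuous
  map \<open>\<Phi>\<close> into \<open>\<real>\<^sup>H\<close> sends a compact set \<open>K\<close> onto a set containing \<open>S\<close>, then the pointwise closure
  of \<open>S\<close> lies in \<open>\<Phi>(K)\<close>. The hull of a bounded function is compact, so to show that the hull of
  \<open>k\<close> over \<open>H\<close> is norm separable it is enough to write the translates of \<open>k\<close> by \<open>H\<close> as values of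
  such a \<open>\<Phi>\<close> on a compact set that is separable for a pseudometric controlling the sup norm. The
  following choices of \<open>K\<close> carry the proof.

  \<^item> For sums and products of Veech functions \<open>f\<close>, \<open>k\<close>, take the product of their two hulls and the
    pointwise operation. For a uniform limit, the hull of the limit lies in the hull of an
    approximant plus a small cube.
  \<^item> For a left translate by \<open>g\<close>, take the hull of \<open>f\<close> over a countable subgroup containing \<open>H\<close>
    and \<open>g\<close>. For a pointwise limit \<open>k\<close> of right translates of \<open>f\<close>, countably many translations
    suffice to approximate \<open>k\<close> on \<open>H\<close>; over the countable subgroup that they generate together
    with \<open>H\<close>, the function \<open>k\<close> becomes the restriction of an element of the hull of \<open>f\<close>
    (\<open>Veech_translate_hull\<close>).
  \<^item> For an Asplund function, \<open>K\<close> is the whole system \<open>Y\<close>, mapped to \<open>\<real>\<^sup>H\<close> by evaluating \<open>F\<close>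
    along \<open>H\<close>-orbits.

  Point-universality follows from stability under limits of right translates. A functional \<open>x\<close> on a
  closed invariant algebra is a limit of evaluations, because otherwise some nonnegative element of
  its kernel would be bounded away from 0, hence invertible
  (\<open>Gelfand_space_approx_evaluation\<close>). Therefore \<open>g \<mapsto> x(\<^sub>gf)\<close> is a limit of right translates of \<open>f\<close>
  and belongs to the algebra, and composing functionals with \<open>f \<mapsto> (g \<mapsto> x(\<^sub>gf))\<close> is the required map.

  If \<open>G\<close> is separable, the hull of a Veech function \<open>f\<close> over all of \<open>G\<close> is itself a compact
  \<open>G\<close>-system. Its elements are equicontinuous, so restricting them to a countable dense subgroup
  loses nothing of the norm; hence it is norm separable and exhibits \<open>f\<close> as an s-Asplund function.
\<close>

section \<open>Suprema and separability\<close>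

abbreviation sup_dist :: "'a set \<Rightarrow> ('a \<Rightarrow> real) \<Rightarrow> ('a \<Rightarrow> real) \<Rightarrow> real" where
  "sup_dist S u w \<equiv> sup_norm S (\<lambda>s. u s - w s)"

lemma sup_norm_le:
  assumes "S \<noteq> {}" "\<And>s. s \<in> S \<Longrightarrow> \<bar>u s\<bar> \<le> c"
  shows "sup_norm S u \<le> c"
  unfolding sup_norm_def using assms by (rule cSUP_least)

lemma abs_le_sup_norm:
  assumes "\<And>s. s \<in> S \<Longrightarrow> \<bar>u s\<bar> \<le> c" "s \<in> S"
  shows "\<bar>u s\<bar> \<le> sup_norm S u"
  unfolding sup_norm_def
  by (rule cSUP_upper[OF assms(2)]) (use assms(1) in \<open>auto intro!: bdd_aboveI\<close>)

lemma abs_diff_le_sup_dist: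
  assumes "\<And>s. s \<in> S \<Longrightarrow> \<bar>u s\<bar> \<le> c" "\<And>s. s \<in> S \<Longrightarrow> \<bar>w s\<bar> \<le> c" "s \<in> S"
  shows "\<bar>u s - w s\<bar> \<le> sup_dist S u w"
proof (rule abs_le_sup_norm[where c = "2 * c"])
  show "\<bar>u t - w t\<bar> \<le> 2 * c" if "t \<in> S" for t
    using assms(1)[OF that] assms(2)[OF that] by linarith
qed (fact assms(3))

text \<open>A countable dense set is pulled back from \<open>K\<close> along a correspondence \<open>R\<close>. A relation
is used instead of a map, and an error \<open>\<epsilon>\<close> is allowed, so that \<open>K\<close> may also be a mere approximation of
\<open>S\<close>, as for uniform limits. The estimate combines the
triangle inequality for \<open>d'\<close> with the comparison of \<open>d\<close> and \<open>d'\<close>.\<close>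

lemma separable_wrt_transfer:
  assumes "\<And>\<epsilon>. \<epsilon> > 0 \<Longrightarrow> \<exists>(K :: 'b set) d' R. separable_wrt d' K \<and> (\<forall>s\<in>S. \<exists>a\<in>K. R s a) \<and>
      (\<forall>s\<in>S. \<forall>t\<in>S. \<forall>a\<in>K. \<forall>b\<in>K. \<forall>c\<in>K. R s a \<longrightarrow> R t b \<longrightarrow> d s t \<le> d' a c + d' b c + \<epsilon>)"
  shows "separable_wrt d S"
proof -
  have net: "\<exists>D\<subseteq>S. countable D \<and> (\<forall>x\<in>S. \<exists>y\<in>D. d x y < \<epsilon>)" if "\<epsilon> > 0" for \<epsilon>
  proof -
    from assms[of "\<epsilon> / 3"] that obtain K :: "'b set" and d' R where K: "separable_wrt d' K \<and>
        (\<forall>s\<in>S. \<exists>a\<in>K. R s a) \<and>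
        (\<forall>s\<in>S. \<forall>t\<in>S. \<forall>a\<in>K. \<forall>b\<in>K. \<forall>c\<in>K. R s a \<longrightarrow> R t b \<longrightarrow> d s t \<le> d' a c + d' b c + \<epsilon> / 3)"
      by auto
    then have sep: "separable_wrt d' K" and tot: "\<And>s. s \<in> S \<Longrightarrow> \<exists>a\<in>K. R s a" by simp_all
    have tri: "d s t \<le> d' a c + d' b c + \<epsilon> / 3"
      if "s \<in> S" "t \<in> S" "a \<in> K" "b \<in> K" "c \<in> K" "R s a" "R t b" for s t a b c
      using K that by blast
    obtain D where D: "D \<subseteq> K" "countable D" and dense: "\<And>x e. x \<in> K \<Longrightarrow> e > 0 \<Longrightarrow> \<exists>y\<in>D. d' x y < e"
      using sep unfolding separable_wrt_def by blast
    \<comment> \<open>Points of \<open>D\<close> need not correspond to anything in \<open>S\<close>. For those that lie near a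
      partner of some \<open>t \<in> S\<close>, one such \<open>t\<close> is kept.\<close>
    define P where "P c t \<longleftrightarrow> t \<in> S \<and> (\<exists>b\<in>K. R t b \<and> d' b c < \<epsilon> / 3)" for c t
    define D' where "D' = (\<lambda>c. SOME t. P c t) ` {c \<in> D. \<exists>t. P c t}"
    have P: "P c (SOME t. P c t)" if "\<exists>t. P c t" for c using that by (rule someI_ex)
    have "D' \<subseteq> S" using P unfolding D'_def P_def by blast
    moreover have "countable D'" using D(2) by (auto simp: D'_def)
    moreover have "\<exists>y\<in>D'. d x y < \<epsilon>" if x: "x \<in> S" for x
    proof -
      obtain a where a: "a \<in> K" "R x a" using tot[OF x] by blast
      obtain c where c: "c \<in> D" "d' a c < \<epsilon> / 3" using dense[OF a(1), of "\<epsilon> / 3"] \<open>\<epsilon> > 0\<close> by auto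
      have ex: "\<exists>t. P c t" using x a c unfolding P_def by blast
      obtain b where b: "b \<in> K" "R (SOME t. P c t) b" "d' b c < \<epsilon> / 3" and t: "(SOME t. P c t) \<in> S"
        using P[OF ex] unfolding P_def by blast
      have "d x (SOME t. P c t) \<le> d' a c + d' b c + \<epsilon> / 3"
        using tri x t a b c D by blast
      then have "d x (SOME t. P c t) < \<epsilon>" using c(2) b(3) by linarith
      moreover have "(SOME t. P c t) \<in> D'" using c ex by (auto simp: D'_def)
      ultimately show ?thesis by blast
    qed
    ultimately show ?thesis by blast
  qed
  have "\<forall>n. \<exists>D\<subseteq>S. countable D \<and> (\<forall>x\<in>S. \<exists>y\<in>D. d x y < 1 / real (Suc n))"
    using net by simp
  then obtain D where D: "\<And>n. D n \<subseteq> S" "\<And>n. countable (D n)"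
    "\<And>n x. x \<in> S \<Longrightarrow> \<exists>y\<in>D n. d x y < 1 / real (Suc n)"
    by metis
  show ?thesis
    unfolding separable_wrt_def
  proof (intro exI[of _ "\<Union>n. D n"] conjI ballI allI impI)
    fix x and \<epsilon> :: real assume x: "x \<in> S" and "\<epsilon> > 0"
    then obtain n where "1 / real (Suc n) < \<epsilon>" using nat_approx_posE by blast
    moreover obtain y where "y \<in> D n" "d x y < 1 / real (Suc n)" using D(3)[OF x] by blast
    ultimately show "\<exists>y\<in>\<Union>n. D n. d x y < \<epsilon>" by (intro bexI[of _ y]) auto
  qed (use D in auto)
qed

lemma separable_wrt_image:
  fixes K :: "'b set"
  assumes sep: "separable_wrt d' K" and S: "S \<subseteq> \<Phi> ` K"
    and d: "\<And>a b c. a \<in> K \<Longrightarrow> b \<in> K \<Longrightarrow> c \<in> K \<Longrightarrow> d (\<Phi> a) (\<Phi> b) \<le> d' a c + d' b c"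
  shows "separable_wrt d S"
proof (rule separable_wrt_transfer)
  fix \<epsilon> :: real assume "\<epsilon> > 0"
  then have "d (\<Phi> a) (\<Phi> b) \<le> d' a c + d' b c + \<epsilon>" if "a \<in> K" "b \<in> K" "c \<in> K" for a b c
    using d[OF that] by linarith
  with sep S show "\<exists>(K :: 'b set) d' R. separable_wrt d' K \<and> (\<forall>s\<in>S. \<exists>a\<in>K. R s a) \<and>
      (\<forall>s\<in>S. \<forall>t\<in>S. \<forall>a\<in>K. \<forall>b\<in>K. \<forall>c\<in>K. R s a \<longrightarrow> R t b \<longrightarrow> d s t \<le> d' a c + d' b c + \<epsilon>)"
    by (intro exI[of _ K] exI[of _ d'] exI[of _ "\<lambda>s a. s = \<Phi> a"]) blast
qed

lemma separable_wrt_Times: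
  assumes "separable_wrt d S" "separable_wrt d' T" and "C \<ge> 0"
  shows "separable_wrt (\<lambda>p q. C * (d (fst p) (fst q) + d' (snd p) (snd q))) (S \<times> T)"
proof -
  obtain D where D: "D \<subseteq> S" "countable D" "\<And>x e. x \<in> S \<Longrightarrow> e > 0 \<Longrightarrow> \<exists>y\<in>D. d x y < e"
    using assms unfolding separable_wrt_def by blast
  obtain D' where D': "D' \<subseteq> T" "countable D'" "\<And>x e. x \<in> T \<Longrightarrow> e > 0 \<Longrightarrow> \<exists>y\<in>D'. d' x y < e"
    using assms unfolding separable_wrt_def by blast
  show ?thesis
    unfolding separable_wrt_def
  proof (intro exI[of _ "D \<times> D'"] conjI ballI allI impI)
    fix x and \<epsilon> :: real assume x: "x \<in> S \<times> T" and "\<epsilon> > 0"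
    define e where "e = \<epsilon> / (2 * (C + 1))"
    have "e > 0" using \<open>\<epsilon> > 0\<close> \<open>C \<ge> 0\<close> by (simp add: e_def)
    obtain y y' where y: "y \<in> D" "d (fst x) y < e" "y' \<in> D'" "d' (snd x) y' < e"
      using D(3)[of "fst x" e] D'(3)[of "snd x" e] x \<open>e > 0\<close> by auto
    have "C * (d (fst x) y + d' (snd x) y') \<le> C * (2 * e)"
      using y \<open>C \<ge> 0\<close> by (intro mult_left_mono) auto
    also have "\<dots> < (C + 1) * (2 * e)" using \<open>e > 0\<close> by simp
    also have "\<dots> = \<epsilon>" using \<open>C \<ge> 0\<close> by (simp add: e_def field_simps)
    finally show "\<exists>q\<in>D \<times> D'. C * (d (fst x) (fst q) + d' (snd x) (snd q)) < \<epsilon>"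
      using y by (intro bexI[of _ "(y, y')"]) auto
  qed (use D D' in auto)
qed


section \<open>Pointwise closures\<close>

lemma in_powertop_closure_iff:
  assumes S: "S \<subseteq> extensional I"
  shows "u \<in> powertop_real I closure_of S \<longleftrightarrow> u \<in> extensional I \<and>
    (\<forall>E \<epsilon>. finite E \<longrightarrow> E \<subseteq> I \<longrightarrow> \<epsilon> > 0 \<longrightarrow> (\<exists>s\<in>S. \<forall>i\<in>E. \<bar>s i - u i\<bar> < \<epsilon>))"
    (is "?L \<longleftrightarrow> ?R")
proof
  assume L: ?L
  then have u: "u \<in> extensional I" by (auto simp: in_closure_of PiE_def)
  moreover have "\<exists>s\<in>S. \<forall>i\<in>E. \<bar>s i - u i\<bar> < \<epsilon>" if E: "finite E" "E \<subseteq> I" and "\<epsilon> > 0" for E \<epsilon>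
  proof -
    define T where "T = (\<Pi>\<^sub>E i\<in>I. if i \<in> E then ball (u i) \<epsilon> else UNIV)"
    have "openin (powertop_real I) T"
      unfolding T_def openin_PiE_gen using E
      by (auto intro!: disjI2 finite_subset[OF _ E(1)])
    moreover have "u \<in> T" using u \<open>\<epsilon> > 0\<close> by (auto simp: T_def PiE_def)
    ultimately obtain s where s: "s \<in> S" "s \<in> T" using L unfolding in_closure_of by blast
    have "\<bar>s i - u i\<bar> < \<epsilon>" if "i \<in> E" for i
    proof -
      have "s i \<in> ball (u i) \<epsilon>" using s(2) that E by (auto simp: T_def PiE_def Pi_def)
      then show ?thesis by (simp add: dist_real_def abs_minus_commute)
    qed
    with s show ?thesis by blast
  qed
  ultimately show ?R by blast
next
  assume R: ?R
  show ?L
    unfolding in_closure_of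
  proof (intro conjI allI impI)
    show "u \<in> topspace (powertop_real I)" using R by (simp add: PiE_def)
    fix T assume T: "u \<in> T \<and> openin (powertop_real I) T"
    then obtain U where U: "finite {i \<in> I. U i \<noteq> UNIV}" "\<And>i. i \<in> I \<Longrightarrow> open (U i)"
      "u \<in> Pi\<^sub>E I U" "Pi\<^sub>E I U \<subseteq> T"
      unfolding openin_product_topology_alt by auto
    have "\<exists>e>0. ball (u i) e \<subseteq> U i" if "i \<in> I" for i
      using U(2)[OF that] U(3) that by (meson PiE_mem open_contains_ball)
    then obtain e where e: "\<And>i. i \<in> I \<Longrightarrow> e i > 0 \<and> ball (u i) (e i) \<subseteq> U i" by metis
    define E where "E = {i \<in> I. U i \<noteq> UNIV}"
    define \<epsilon> where "\<epsilon> = Min (insert 1 (e ` E))"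
    have fin: "finite E" using U(1) by (simp add: E_def)
    have "\<epsilon> > 0" using e fin by (auto simp: \<epsilon>_def E_def)
    moreover have "\<epsilon> \<le> e i" if "i \<in> E" for i using that fin by (simp add: \<epsilon>_def)
    moreover obtain s where s: "s \<in> S" "\<forall>i\<in>E. \<bar>s i - u i\<bar> < \<epsilon>"
      using R fin \<open>\<epsilon> > 0\<close> by (metis (no_types, lifting) E_def mem_Collect_eq subsetI)
    ultimately have "s i \<in> U i" if "i \<in> I" for i
    proof (cases "i \<in> E")
      case True
      then have "\<bar>s i - u i\<bar> < e i" using s(2) \<open>\<And>i. i \<in> E \<Longrightarrow> \<epsilon> \<le> e i\<close> by fastforce
      then show ?thesis using e[OF that] by (auto simp: dist_real_def abs_minus_commute)
    qed (use that in \<open>auto simp: E_def\<close>)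
    then have "s \<in> T" using U(4) s S by (auto simp: PiE_def)
    with s show "\<exists>y. y \<in> S \<and> y \<in> T" by blast
  qed
qed

text \<open>The image of a compact set is compact, hence closed in the Hausdorff space \<open>\<real>\<^sup>I\<close>. This is
the compactness step behind every covering of a hull below.\<close>

lemma closure_subset_compact_image:
  assumes "compactin X K" "continuous_map X (powertop_real I) \<Phi>" "S \<subseteq> \<Phi> ` K"
  shows "powertop_real I closure_of S \<subseteq> \<Phi> ` K"
proof (rule closure_of_minimal[OF assms(3)])
  show "closedin (powertop_real I) (\<Phi> ` K)"
    using image_compactin[OF assms(1,2)]
    by (intro compactin_imp_closedin) (auto simp: Hausdorff_space_product_topology)
qed

text \<open>Basic neighbourhoods in \<open>\<real>\<^sup>H\<close> constrain finitely many coordinates, which turns membership in the hull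
into an approximation property on finite sets.\<close>

lemma in_translate_hull_iff:
  "u \<in> translate_hull H f \<longleftrightarrow> u \<in> extensional H \<and>
    (\<forall>E \<epsilon>. finite E \<longrightarrow> E \<subseteq> H \<longrightarrow> \<epsilon> > 0 \<longrightarrow> (\<exists>p\<in>H. \<forall>h\<in>E. \<bar>f (h + p) - u h\<bar> < \<epsilon>))"
proof -
  have eq: "(\<exists>s\<in>(\<lambda>p. restrict (\<lambda>h. f (h + p)) H) ` H. \<forall>h\<in>E. \<bar>s h - u h\<bar> < \<epsilon>) \<longleftrightarrow>
      (\<exists>p\<in>H. \<forall>h\<in>E. \<bar>f (h + p) - u h\<bar> < \<epsilon>)" if "E \<subseteq> H" for E \<epsilon>
    using that by (auto simp: subset_iff)
  have "(\<lambda>p. restrict (\<lambda>h. f (h + p)) H) ` H \<subseteq> extensional H" by auto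
  from in_powertop_closure_iff[OF this, of u] show ?thesis
    unfolding translate_hull_def using eq by meson
qed

lemma translate_in_hull: "p \<in> H \<Longrightarrow> restrict (\<lambda>h. f (h + p)) H \<in> translate_hull H f"
  unfolding in_translate_hull_iff by (force intro!: bexI[of _ p])

lemma translate_hull_bound:
  assumes f: "\<And>x. \<bar>f x\<bar> \<le> B" and u: "u \<in> translate_hull H f" and h: "h \<in> H"
  shows "\<bar>u h\<bar> \<le> B"
proof (rule field_le_epsilon)
  fix e :: real assume "e > 0"
  then obtain p where "\<bar>f (h + p) - u h\<bar> < e"
    using u h unfolding in_translate_hull_iff by (metis empty_subsetI finite.emptyI finite_insert insertI1 insert_subset)
  with f[of "h + p"] show "\<bar>u h\<bar> \<le> B + e" by linarith
qed

lemma compactin_translate_hull: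
  assumes f: "\<And>x. \<bar>f x\<bar> \<le> B"
  shows "compactin (powertop_real H) (translate_hull H f)"
proof (rule closed_compactin)
  show "compactin (powertop_real H) (\<Pi>\<^sub>E h\<in>H. {-B..B})"
    by (simp add: compactin_PiE)
  show "translate_hull H f \<subseteq> (\<Pi>\<^sub>E h\<in>H. {-B..B})"
  proof
    fix u assume u: "u \<in> translate_hull H f"
    then have "u \<in> extensional H" by (simp add: in_translate_hull_iff)
    then show "u \<in> (\<Pi>\<^sub>E h\<in>H. {-B..B})"
      using translate_hull_bound[OF f u] by (auto simp: PiE_def abs_le_iff minus_le_iff)
  qed
  show "closedin (powertop_real H) (translate_hull H f)"
    by (simp add: translate_hull_def)
qed

lemma sup_dist_hull_le:
  assumes f: "\<And>x. \<bar>f x\<bar> \<le> B" and "u \<in> translate_hull H f" "w \<in> translate_hull H f" and "h \<in> H"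
  shows "\<bar>u h - w h\<bar> \<le> sup_dist H u w"
  using assms translate_hull_bound[OF f] by (intro abs_diff_le_sup_dist[where c = B]) auto


section \<open>Right uniformly continuous functions\<close>

lemma RUC_iff:
  "f \<in> RUC \<longleftrightarrow> bounded (range f) \<and> (\<forall>\<epsilon>>0. \<forall>\<^sub>F v in nhds 0. \<forall>g. \<bar>f (v + g) - f g\<bar> < \<epsilon>)"
proof (cases "bounded (range f)")
  case True
  then obtain B where B: "\<And>x. \<bar>f x\<bar> \<le> B" by (auto simp: bounded_iff)
  have d: "\<bar>f (v + g) - f g\<bar> \<le> 2 * B" for v g using B[of "v + g"] B[of g] by linarith
  have "(\<forall>\<epsilon>>0. \<forall>\<^sub>F v in nhds 0. sup_norm UNIV (\<lambda>g. f (v + g) - f g) < \<epsilon>) \<longleftrightarrow>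
        (\<forall>\<epsilon>>0. \<forall>\<^sub>F v in nhds 0. \<forall>g. \<bar>f (v + g) - f g\<bar> < \<epsilon>)"
  proof (intro iffI allI impI)
    fix \<epsilon> :: real
    assume *: "\<forall>\<epsilon>>0. \<forall>\<^sub>F v in nhds 0. sup_norm UNIV (\<lambda>g. f (v + g) - f g) < \<epsilon>" "\<epsilon> > 0"
    then have "\<forall>\<^sub>F v in nhds 0. sup_norm UNIV (\<lambda>g. f (v + g) - f g) < \<epsilon>" by blast
    then show "\<forall>\<^sub>F v in nhds 0. \<forall>g. \<bar>f (v + g) - f g\<bar> < \<epsilon>"
    proof (rule eventually_mono, intro allI)
      fix v g assume "sup_norm UNIV (\<lambda>g. f (v + g) - f g) < \<epsilon>"
      with abs_le_sup_norm[of UNIV "\<lambda>g. f (v + g) - f g", OF d] 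
      show "\<bar>f (v + g) - f g\<bar> < \<epsilon>" by (meson UNIV_I le_less_trans)
    qed
  next
    fix \<epsilon> :: real
    assume *: "\<forall>\<epsilon>>0. \<forall>\<^sub>F v in nhds 0. \<forall>g. \<bar>f (v + g) - f g\<bar> < \<epsilon>" "\<epsilon> > 0"
    have "\<forall>\<^sub>F v in nhds 0. \<forall>g. \<bar>f (v + g) - f g\<bar> < \<epsilon> / 2"
      using *(1) half_gt_zero[OF *(2)] by blast
    then show "\<forall>\<^sub>F v in nhds 0. sup_norm UNIV (\<lambda>g. f (v + g) - f g) < \<epsilon>"
    proof (rule eventually_mono)
      fix v assume "\<forall>g. \<bar>f (v + g) - f g\<bar> < \<epsilon> / 2"
      then have "sup_norm UNIV (\<lambda>g. f (v + g) - f g) \<le> \<epsilon> / 2"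
        by (intro sup_norm_le) (auto intro: less_imp_le)
      with *(2) show "sup_norm UNIV (\<lambda>g. f (v + g) - f g) < \<epsilon>" by linarith
    qed
  qed
  with True show ?thesis by (simp add: RUC_def)
qed (simp add: RUC_def)

lemma RUC_bounded:
  assumes "f \<in> RUC" obtains B where "\<And>x. \<bar>f x\<bar> \<le> B" "B \<ge> 0"
proof -
  obtain B where B: "\<And>x. \<bar>f x\<bar> \<le> B" using assms by (auto simp: RUC_iff bounded_iff)
  moreover have "B \<ge> 0" using B[of 0] by linarith
  ultimately show thesis by (rule that)
qed

lemma RUC_eventually:
  "f \<in> RUC \<Longrightarrow> \<epsilon> > 0 \<Longrightarrow> \<forall>\<^sub>F v in nhds 0. \<forall>g. \<bar>f (v + g) - f g\<bar> < \<epsilon>"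
  by (simp add: RUC_iff)

lemma RUC_I:
  assumes "\<And>x. \<bar>f x\<bar> \<le> B" "\<And>\<epsilon>. \<epsilon> > 0 \<Longrightarrow> \<forall>\<^sub>F v in nhds 0. \<forall>g. \<bar>f (v + g) - f g\<bar> < \<epsilon>"
  shows "f \<in> RUC"
  using assms by (auto simp: RUC_iff bounded_iff)

lemma RUC_uniform_limit:
  assumes F: "\<And>n. F n \<in> RUC" and lim: "uniform_limit UNIV F f sequentially"
  shows "f \<in> RUC"
proof -
  have near: "\<exists>n. \<forall>x. \<bar>F n x - f x\<bar> < \<epsilon>" if "\<epsilon> > 0" for \<epsilon>
    using uniform_limitD[OF lim that] by (auto simp: dist_real_def eventually_sequentially)
  obtain n where n: "\<forall>x. \<bar>F n x - f x\<bar> < 1" using near[of 1] by auto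
  obtain B where B: "\<And>x. \<bar>F n x\<bar> \<le> B" using RUC_bounded[OF F] by blast
  show ?thesis
  proof (rule RUC_I[where B = "B + 1"])
    show "\<bar>f x\<bar> \<le> B + 1" for x using n[rule_format, of x] B[of x] by linarith
    fix \<epsilon> :: real assume "\<epsilon> > 0"
    then obtain m where m: "\<forall>x. \<bar>F m x - f x\<bar> < \<epsilon> / 3" using near[of "\<epsilon> / 3"] by auto
    have "\<forall>\<^sub>F v in nhds 0. \<forall>g. \<bar>F m (v + g) - F m g\<bar> < \<epsilon> / 3"
      by (rule RUC_eventually[OF F]) (use \<open>\<epsilon> > 0\<close> in simp)
    then show "\<forall>\<^sub>F v in nhds 0. \<forall>g. \<bar>f (v + g) - f g\<bar> < \<epsilon>"
    proof (rule eventually_mono, intro allI)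
      fix v g assume "\<forall>g. \<bar>F m (v + g) - F m g\<bar> < \<epsilon> / 3"
      then have "\<bar>F m (v + g) - F m g\<bar> < \<epsilon> / 3" by blast
      then show "\<bar>f (v + g) - f g\<bar> < \<epsilon>"
        using m[rule_format, of "v + g"] m[rule_format, of g] by linarith
    qed
  qed
qed

lemma RUC_left_translate:
  assumes f: "f \<in> RUC"
  shows "left_translate g f \<in> RUC"
proof -
  obtain B where B: "\<And>x. \<bar>f x\<bar> \<le> B" using RUC_bounded[OF f] by blast
  show ?thesis
  proof (rule RUC_I[where B = B])
    show "\<bar>left_translate g f x\<bar> \<le> B" for x by (simp add: left_translate_def B)
    fix \<epsilon> :: real assume "\<epsilon> > 0"
    \<comment> \<open>A perturbation \<open>v\<close> behind \<open>g\<close> is its conjugate by \<open>g\<close> in front of \<open>g\<close>.\<close>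
    have "((\<lambda>v. g + v - g) \<longlongrightarrow> g + 0 - g) (nhds 0)"
      by (intro tendsto_intros filterlim_ident)
    then have "filterlim (\<lambda>v. g + v - g) (nhds 0) (nhds 0)" by simp
    from eventually_compose_filterlim[OF RUC_eventually[OF f \<open>\<epsilon> > 0\<close>] this]
    show "\<forall>\<^sub>F v in nhds 0. \<forall>x. \<bar>left_translate g f (v + x) - left_translate g f x\<bar> < \<epsilon>"
    proof (rule eventually_mono, intro allI)
      fix v x assume "\<forall>x. \<bar>f (g + v - g + x) - f x\<bar> < \<epsilon>"
      then have "\<bar>f (g + v - g + (g + x)) - f (g + x)\<bar> < \<epsilon>" by blast
      then show "\<bar>left_translate g f (v + x) - left_translate g f x\<bar> < \<epsilon>"
        by (simp add: left_translate_def add.assoc[symmetric])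
    qed
  qed
qed

text \<open>The estimate at \<open>g\<close> for a right translate of \<open>f\<close> is the estimate for \<open>f\<close> at another point, and it
survives pointwise limits. So all elements of the hull share the modulus of continuity of \<open>f\<close>.\<close>

lemma translate_hull_modulus:
  assumes w: "w \<in> translate_hull UNIV f" and v: "\<forall>g. \<bar>f (v + g) - f g\<bar> < \<epsilon>"
  shows "\<bar>w (v + g) - w g\<bar> \<le> \<epsilon>"
proof (rule field_le_epsilon)
  fix e :: real assume "e > 0"
  then obtain p where p: "\<forall>h\<in>{v + g, g}. \<bar>f (h + p) - w h\<bar> < e / 2"
    using w unfolding in_translate_hull_iff by (metis finite.simps half_gt_zero iso_tuple_UNIV_I subsetI)
  have "\<bar>f (v + (g + p)) - f (g + p)\<bar> < \<epsilon>" using v by blast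
  moreover have "\<bar>f (v + (g + p)) - w (v + g)\<bar> < e / 2" "\<bar>f (g + p) - w g\<bar> < e / 2"
    using p by (simp_all add: add.assoc)
  ultimately show "\<bar>w (v + g) - w g\<bar> \<le> \<epsilon> + e" by linarith
qed

lemma translate_hull_subset_RUC:
  assumes f: "f \<in> RUC" and w: "w \<in> translate_hull UNIV f"
  shows "w \<in> RUC"
proof -
  obtain B where B: "\<And>x. \<bar>f x\<bar> \<le> B" using RUC_bounded[OF f] by blast
  show ?thesis
  proof (rule RUC_I[where B = B])
    show "\<bar>w x\<bar> \<le> B" for x using translate_hull_bound[OF B w] by simp
    fix \<epsilon> :: real assume "\<epsilon> > 0"
    then have "\<forall>\<^sub>F v in nhds 0. \<forall>g. \<bar>f (v + g) - f g\<bar> < \<epsilon> / 2" by (intro RUC_eventually[OF f]) simp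
    then show "\<forall>\<^sub>F v in nhds 0. \<forall>g. \<bar>w (v + g) - w g\<bar> < \<epsilon>"
    proof (rule eventually_mono, intro allI)
      fix v g assume "\<forall>g. \<bar>f (v + g) - f g\<bar> < \<epsilon> / 2"
      from translate_hull_modulus[OF w this, of g] \<open>\<epsilon> > 0\<close>
      show "\<bar>w (v + g) - w g\<bar> < \<epsilon>" by linarith
    qed
  qed
qed

lemma translate_hull_equicontinuous:
  assumes f: "f \<in> RUC" and "\<epsilon> > 0"
  shows "\<forall>\<^sub>F g in nhds b. \<forall>w\<in>translate_hull UNIV f. \<bar>w (a + g) - w (a + b)\<bar> < \<epsilon>"
proof -
  \<comment> \<open>The element that moves \<open>a + b\<close> to \<open>a + g\<close> from the left tends to the identity.\<close>
  have "((\<lambda>g. a + g - b - a) \<longlongrightarrow> a + b - b - a) (nhds b)"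
    by (intro tendsto_intros filterlim_ident)
  then have "filterlim (\<lambda>g. a + g - b - a) (nhds 0) (nhds b)" by simp
  moreover have "\<forall>\<^sub>F v in nhds 0. \<forall>g. \<bar>f (v + g) - f g\<bar> < \<epsilon> / 2"
    by (rule RUC_eventually[OF f]) (use \<open>\<epsilon> > 0\<close> in simp)
  ultimately have "\<forall>\<^sub>F g in nhds b. \<forall>x. \<bar>f (a + g - b - a + x) - f x\<bar> < \<epsilon> / 2"
    by (rule eventually_compose_filterlim[rotated])
  then show ?thesis
  proof (rule eventually_mono, intro ballI)
    fix g w assume g: "\<forall>x. \<bar>f (a + g - b - a + x) - f x\<bar> < \<epsilon> / 2" and w: "w \<in> translate_hull UNIV f"
    have "a + g - b - a + (a + b) = a + g" by (simp add: add.assoc[symmetric])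
    with translate_hull_modulus[OF w g, of "a + b"] \<open>\<epsilon> > 0\<close>
    show "\<bar>w (a + g) - w (a + b)\<bar> < \<epsilon>" by simp
  qed
qed


section \<open>The algebra of Veech functions\<close>

lemma VeechI:
  assumes "f \<in> RUC"
    and "\<And>H. subgroup_set H \<Longrightarrow> countable H \<Longrightarrow> separable_wrt (sup_dist H) (translate_hull H f)"
  shows "f \<in> Veech"
  using assms by (simp add: Veech_def)

lemma VeechD:
  assumes "f \<in> Veech"
  shows "f \<in> RUC"
    and "subgroup_set H \<Longrightarrow> countable H \<Longrightarrow> separable_wrt (sup_dist H) (translate_hull H f)"
  using assms by (simp_all add: Veech_def)

lemma subgroup_set_nonempty: "subgroup_set H \<Longrightarrow> H \<noteq> {}"
  by (auto simp: subgroup_set_def)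

lemma countable_subgroup_containing:
  fixes S :: "'g::group_add set"
  assumes "countable S"
  obtains H where "subgroup_set H" "countable H" "S \<subseteq> H"
proof
  let ?L = "lists (S \<union> uminus ` S)"
  define H where "H = sum_list ` ?L"
  show "countable H" using assms by (simp add: H_def)
  show "S \<subseteq> H"
  proof
    fix s assume "s \<in> S"
    then have "sum_list [s] \<in> H" unfolding H_def by (intro imageI) auto
    then show "s \<in> H" by simp
  qed
  have neg: "- sum_list xs = sum_list (rev (map uminus xs))" for xs :: "'g list"
    by (induction xs) (simp_all add: minus_add)
  show "subgroup_set H"
    unfolding subgroup_set_def
  proof (intro conjI ballI)
    show "0 \<in> H" unfolding H_def by (rule image_eqI[of _ _ "[]"]) auto
    fix x assume "x \<in> H"
    then obtain xs where xs: "xs \<in> ?L" "x = sum_list xs" by (auto simp: H_def)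
    have "rev (map uminus xs) \<in> ?L" using xs(1) by (auto simp: in_lists_conv_set)
    then show "- x \<in> H" unfolding H_def xs(2) neg by (rule imageI)
    fix y assume "y \<in> H"
    then obtain ys where ys: "ys \<in> ?L" "y = sum_list ys" by (auto simp: H_def)
    have "sum_list (xs @ ys) \<in> H" unfolding H_def using xs ys by (intro imageI) auto
    then show "x + y \<in> H" by (simp add: xs ys)
  qed
qed

lemma Veech_const: "(\<lambda>_. c) \<in> Veech"
proof (rule VeechI)
  show "(\<lambda>_. c) \<in> RUC" by (rule RUC_I[where B = "\<bar>c\<bar>"]) auto
  fix H :: "'a set" assume H: "subgroup_set H"
  have c: "u h = c" if "u \<in> translate_hull H (\<lambda>_. c)" "h \<in> H" for u h
  proof (rule ccontr)
    assume "u h \<noteq> c"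
    with that have "\<exists>p\<in>H. \<forall>i\<in>{h}. \<bar>c - u i\<bar> < \<bar>c - u h\<bar>"
      unfolding in_translate_hull_iff by (metis empty_subsetI eq_iff_diff_eq_0 finite.emptyI finite_insert insert_subset zero_less_abs_iff)
    then show False by simp
  qed
  have "sup_dist H u w \<le> 0"
    if "u \<in> translate_hull H (\<lambda>_. c)" "w \<in> translate_hull H (\<lambda>_. c)" for u w
    using c[OF that(1)] c[OF that(2)] by (intro sup_norm_le subgroup_set_nonempty[OF H]) simp
  moreover have "restrict (\<lambda>_. c) H \<in> translate_hull H (\<lambda>_. c)"
    using H by (intro translate_in_hull[of 0]) (simp add: subgroup_set_def)
  ultimately show "separable_wrt (sup_dist H) (translate_hull H (\<lambda>_. c))"
    unfolding separable_wrt_def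
    by (intro exI[of _ "{restrict (\<lambda>_. c) H}"]) fastforce
qed

lemma continuous_map_pointwise_binary:
  fixes m :: "real \<Rightarrow> real \<Rightarrow> real"
  assumes "continuous_on UNIV (\<lambda>p. m (fst p) (snd p))"
  shows "continuous_map (prod_topology (powertop_real H) (powertop_real H)) (powertop_real H)
    (\<lambda>p. restrict (\<lambda>h. m (fst p h) (snd p h)) H)"
  unfolding continuous_map_componentwise
proof (intro conjI ballI)
  fix h assume h: "h \<in> H"
  have "continuous_map (prod_topology (powertop_real H) (powertop_real H))
      (prod_topology euclideanreal euclideanreal) (\<lambda>p. (fst p h, snd p h))"
    using h continuous_map_compose[OF continuous_map_fst continuous_map_product_projection[OF h]]
      continuous_map_compose[OF continuous_map_snd continuous_map_product_projection[OF h]]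
    by (intro continuous_map_pairedI) (auto simp: o_def)
  moreover have "continuous_map (prod_topology euclideanreal euclideanreal) euclideanreal
      (\<lambda>p. m (fst p) (snd p))"
    using assms by (simp add: euclidean_product_topology)
  ultimately have "continuous_map (prod_topology (powertop_real H) (powertop_real H)) euclideanreal
      ((\<lambda>p. m (fst p) (snd p)) \<circ> (\<lambda>p. (fst p h, snd p h)))"
    by (rule continuous_map_compose)
  then show "continuous_map (prod_topology (powertop_real H) (powertop_real H)) euclideanreal
      (\<lambda>p. restrict (\<lambda>h. m (fst p h) (snd p h)) H h)"
    using h by (simp add: o_def)
qed auto

lemma RUC_binary:
  fixes m :: "real \<Rightarrow> real \<Rightarrow> real"
  assumes f: "f \<in> RUC" and k: "k \<in> RUC"
    and lip: "\<And>M. \<exists>C\<ge>0. \<forall>a b a' b'. \<bar>a\<bar> \<le> M \<longrightarrow> \<bar>b\<bar> \<le> M \<longrightarrow> \<bar>a'\<bar> \<le> M \<longrightarrow> \<bar>b'\<bar> \<le> M \<longrightarrow>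
        \<bar>m a b - m a' b'\<bar> \<le> C * (\<bar>a - a'\<bar> + \<bar>b - b'\<bar>)"
  shows "(\<lambda>x. m (f x) (k x)) \<in> RUC"
proof -
  obtain A where A: "\<And>x. \<bar>f x\<bar> \<le> A" "A \<ge> 0" using RUC_bounded[OF f] by blast
  obtain B where B: "\<And>x. \<bar>k x\<bar> \<le> B" "B \<ge> 0" using RUC_bounded[OF k] by blast
  define M where "M = A + B"
  have M: "\<bar>f x\<bar> \<le> M" "\<bar>k x\<bar> \<le> M" "M \<ge> 0" for x
    using A(1)[of x] B(1)[of x] A(2) B(2) by (simp_all add: M_def)
  obtain C where C: "C \<ge> 0" "\<And>a b a' b'. \<bar>a\<bar> \<le> M \<Longrightarrow> \<bar>b\<bar> \<le> M \<Longrightarrow> \<bar>a'\<bar> \<le> M \<Longrightarrow> \<bar>b'\<bar> \<le> M \<Longrightarrow>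
        \<bar>m a b - m a' b'\<bar> \<le> C * (\<bar>a - a'\<bar> + \<bar>b - b'\<bar>)"
    using lip[of M] by blast
  show ?thesis
  proof (rule RUC_I[where B = "\<bar>m 0 0\<bar> + C * (2 * M)"])
    fix x
    have "\<bar>m (f x) (k x) - m 0 0\<bar> \<le> C * (\<bar>f x - 0\<bar> + \<bar>k x - 0\<bar>)"
      using M by (intro C) auto
    also have "\<dots> \<le> C * (2 * M)" using M(1)[of x] M(2)[of x] C(1) by (intro mult_left_mono) auto
    finally show "\<bar>m (f x) (k x)\<bar> \<le> \<bar>m 0 0\<bar> + C * (2 * M)" by linarith
  next
    fix \<epsilon> :: real assume "\<epsilon> > 0"
    define e where "e = \<epsilon> / (2 * (C + 1))"
    have "e > 0" using \<open>\<epsilon> > 0\<close> \<open>C \<ge> 0\<close> by (simp add: e_def)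
    from RUC_eventually[OF f this] RUC_eventually[OF k this]
    show "\<forall>\<^sub>F v in nhds 0. \<forall>g. \<bar>m (f (v + g)) (k (v + g)) - m (f g) (k g)\<bar> < \<epsilon>"
    proof eventually_elim
      case (elim v)
      show ?case
      proof
        fix g
        have "\<bar>m (f (v + g)) (k (v + g)) - m (f g) (k g)\<bar>
            \<le> C * (\<bar>f (v + g) - f g\<bar> + \<bar>k (v + g) - k g\<bar>)"
          using M by (intro C) auto
        also have "\<dots> \<le> C * (e + e)"
          using elim C(1) by (intro mult_left_mono add_mono) (auto intro: less_imp_le)
        also have "\<dots> < (C + 1) * (2 * e)" using \<open>e > 0\<close> by simp
        also have "\<dots> = \<epsilon>" using \<open>C \<ge> 0\<close> by (simp add: e_def field_simps)
        finally show "\<bar>m (f (v + g)) (k (v + g)) - m (f g) (k g)\<bar> < \<epsilon>" .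
      qed
    qed
  qed
qed

text \<open>Translates of \<open>m(f,k)\<close> are \<open>m\<close> applied to pairs of translates, so the hull of \<open>m(f,k)\<close> is covered by
the product of the hulls of \<open>f\<close> and \<open>k\<close>. The Lipschitz bound, on the square containing all values,
makes this covering map Lipschitz for the sup norms. Sums and products are the instances of
interest.\<close>

lemma Veech_binary:
  fixes m :: "real \<Rightarrow> real \<Rightarrow> real" and f k :: "'g::topological_group_add \<Rightarrow> real"
  assumes f: "f \<in> Veech" and k: "k \<in> Veech"
    and cont: "continuous_on UNIV (\<lambda>p. m (fst p) (snd p))"
    and lip: "\<And>M. \<exists>C\<ge>0. \<forall>a b a' b'. \<bar>a\<bar> \<le> M \<longrightarrow> \<bar>b\<bar> \<le> M \<longrightarrow> \<bar>a'\<bar> \<le> M \<longrightarrow> \<bar>b'\<bar> \<le> M \<longrightarrow>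
        \<bar>m a b - m a' b'\<bar> \<le> C * (\<bar>a - a'\<bar> + \<bar>b - b'\<bar>)"
  shows "(\<lambda>x. m (f x) (k x)) \<in> Veech"
proof (rule VeechI)
  show "(\<lambda>x. m (f x) (k x)) \<in> RUC"
    by (rule RUC_binary[OF VeechD(1)[OF f] VeechD(1)[OF k] lip])
  fix H :: "'g set" assume H: "subgroup_set H" "countable H"
  obtain A where A: "\<And>x. \<bar>f x\<bar> \<le> A" "A \<ge> 0" using RUC_bounded[OF VeechD(1)[OF f]] by blast
  obtain B where B: "\<And>x. \<bar>k x\<bar> \<le> B" "B \<ge> 0" using RUC_bounded[OF VeechD(1)[OF k]] by blast
  define M where "M = A + B"
  have M: "\<And>x. \<bar>f x\<bar> \<le> M" "\<And>x. \<bar>k x\<bar> \<le> M"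
    using A B by (simp_all add: M_def add_increasing add_increasing2)
  obtain C where C: "C \<ge> 0" "\<And>a b a' b'. \<bar>a\<bar> \<le> M \<Longrightarrow> \<bar>b\<bar> \<le> M \<Longrightarrow> \<bar>a'\<bar> \<le> M \<Longrightarrow> \<bar>b'\<bar> \<le> M \<Longrightarrow>
        \<bar>m a b - m a' b'\<bar> \<le> C * (\<bar>a - a'\<bar> + \<bar>b - b'\<bar>)"
    using lip[of M] by blast
  let ?K = "translate_hull H f \<times> translate_hull H k"
  let ?\<Phi> = "\<lambda>p. restrict (\<lambda>h. m (fst p h) (snd p h)) H"
  have sub: "translate_hull H (\<lambda>x. m (f x) (k x)) \<subseteq> ?\<Phi> ` ?K"
    unfolding translate_hull_def[of H "\<lambda>x. m (f x) (k x)"]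
  proof (rule closure_subset_compact_image[OF _ continuous_map_pointwise_binary[OF cont]])
    show "compactin (prod_topology (powertop_real H) (powertop_real H)) ?K"
      using compactin_translate_hull M by (auto simp: compactin_Times)
    show "(\<lambda>p. restrict (\<lambda>h. m (f (h + p)) (k (h + p))) H) ` H \<subseteq> ?\<Phi> ` ?K"
    proof
      fix u assume "u \<in> (\<lambda>p. restrict (\<lambda>h. m (f (h + p)) (k (h + p))) H) ` H"
      then obtain p where p: "p \<in> H" "u = restrict (\<lambda>h. m (f (h + p)) (k (h + p))) H" by blast
      have "u = ?\<Phi> (restrict (\<lambda>h. f (h + p)) H, restrict (\<lambda>h. k (h + p)) H)"
        using p(2) by (auto simp: fun_eq_iff)
      then show "u \<in> ?\<Phi> ` ?K" using translate_in_hull[OF p(1)] by blast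
    qed
  qed
  show "separable_wrt (sup_dist H) (translate_hull H (\<lambda>x. m (f x) (k x)))"
  proof (rule separable_wrt_image[OF _ sub])
    show "separable_wrt (\<lambda>p q. C * (sup_dist H (fst p) (fst q) + sup_dist H (snd p) (snd q))) ?K"
      by (intro separable_wrt_Times VeechD(2) f k H C)
    fix p q r assume pqr: "p \<in> ?K" "q \<in> ?K" "r \<in> ?K"
    show "sup_dist H (?\<Phi> p) (?\<Phi> q) \<le> C * (sup_dist H (fst p) (fst r) + sup_dist H (snd p) (snd r))
        + C * (sup_dist H (fst q) (fst r) + sup_dist H (snd q) (snd r))"
    proof (rule sup_norm_le[OF subgroup_set_nonempty[OF H(1)]])
      fix h assume h: "h \<in> H"
      have bnd: "\<bar>fst s h\<bar> \<le> M" "\<bar>snd s h\<bar> \<le> M" if "s \<in> ?K" for s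
        using that translate_hull_bound[OF M(1) _ h] translate_hull_bound[OF M(2) _ h] by auto
      have tri: "\<bar>m (fst s h) (snd s h) - m (fst r h) (snd r h)\<bar>
          \<le> C * (sup_dist H (fst s) (fst r) + sup_dist H (snd s) (snd r))" if s: "s \<in> ?K" for s
      proof -
        have "\<bar>m (fst s h) (snd s h) - m (fst r h) (snd r h)\<bar>
            \<le> C * (\<bar>fst s h - fst r h\<bar> + \<bar>snd s h - snd r h\<bar>)"
          by (intro C bnd s pqr)
        also have "\<dots> \<le> C * (sup_dist H (fst s) (fst r) + sup_dist H (snd s) (snd r))"
          using s pqr h C(1)
          by (intro mult_left_mono add_mono sup_dist_hull_le[OF M(1)] sup_dist_hull_le[OF M(2)]) auto
        finally show ?thesis .
      qed
      show "\<bar>?\<Phi> p h - ?\<Phi> q h\<bar> \<le> C * (sup_dist H (fst p) (fst r) + sup_dist H (snd p) (snd r))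
        + C * (sup_dist H (fst q) (fst r) + sup_dist H (snd q) (snd r))"
        using tri[OF pqr(1)] tri[OF pqr(2)] h by simp
    qed
  qed
qed

lemma Veech_add:
  assumes "f \<in> Veech" "k \<in> Veech" shows "(\<lambda>x. f x + k x) \<in> Veech"
proof (rule Veech_binary[OF assms, of "(+)"])
  show "continuous_on UNIV (\<lambda>p::real \<times> real. fst p + snd p)" by (intro continuous_intros)
  show "\<exists>C\<ge>0. \<forall>a b a' b'. \<bar>a\<bar> \<le> M \<longrightarrow> \<bar>b\<bar> \<le> M \<longrightarrow> \<bar>a'\<bar> \<le> M \<longrightarrow> \<bar>b'\<bar> \<le> M \<longrightarrow>
        \<bar>a + b - (a' + b')\<bar> \<le> C * (\<bar>a - a'\<bar> + \<bar>b - b'\<bar>)" for M :: real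
    by (intro exI[of _ 1]) auto
qed

lemma Veech_mult:
  assumes "f \<in> Veech" "k \<in> Veech" shows "(\<lambda>x. f x * k x) \<in> Veech"
proof (rule Veech_binary[OF assms, of "(*)"])
  show "continuous_on UNIV (\<lambda>p::real \<times> real. fst p * snd p)" by (intro continuous_intros)
  show "\<exists>C\<ge>0. \<forall>a b a' b'. \<bar>a\<bar> \<le> M \<longrightarrow> \<bar>b\<bar> \<le> M \<longrightarrow> \<bar>a'\<bar> \<le> M \<longrightarrow> \<bar>b'\<bar> \<le> M \<longrightarrow>
        \<bar>a * b - a' * b'\<bar> \<le> C * (\<bar>a - a'\<bar> + \<bar>b - b'\<bar>)" for M :: real
  proof (intro exI[of _ "\<bar>M\<bar>"] conjI allI impI)
    fix a b a' b' :: real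
    assume *: "\<bar>a\<bar> \<le> M" "\<bar>b\<bar> \<le> M" "\<bar>a'\<bar> \<le> M" "\<bar>b'\<bar> \<le> M"
    have "\<bar>a * b - a' * b'\<bar> = \<bar>(a - a') * b + a' * (b - b')\<bar>" by (simp add: algebra_simps)
    also have "\<dots> \<le> \<bar>a - a'\<bar> * \<bar>b\<bar> + \<bar>a'\<bar> * \<bar>b - b'\<bar>"
      by (metis abs_mult abs_triangle_ineq)
    also have "\<dots> \<le> \<bar>a - a'\<bar> * \<bar>M\<bar> + \<bar>M\<bar> * \<bar>b - b'\<bar>"
      using * by (intro add_mono mult_left_mono mult_right_mono) auto
    finally show "\<bar>a * b - a' * b'\<bar> \<le> \<bar>M\<bar> * (\<bar>a - a'\<bar> + \<bar>b - b'\<bar>)" by (simp add: algebra_simps)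
  qed simp
qed

text \<open>Each translate of \<open>k\<close> is a translate of \<open>f\<close> plus an element of the cube with side \<open>[-\<epsilon>, \<epsilon>]\<close>, and the
sum of the hull of \<open>f\<close> and this cube is compact.\<close>

lemma translate_hull_perturb:
  assumes f: "\<And>x. \<bar>f x\<bar> \<le> B" and near: "\<And>x. \<bar>k x - f x\<bar> \<le> \<epsilon>" and u: "u \<in> translate_hull H k"
  shows "\<exists>w\<in>translate_hull H f. \<forall>h\<in>H. \<bar>u h - w h\<bar> \<le> \<epsilon>"
proof -
  let ?K = "translate_hull H f \<times> (\<Pi>\<^sub>E h\<in>H. {-\<epsilon>..\<epsilon>})"
  let ?\<Phi> = "\<lambda>p. restrict (\<lambda>h. fst p h + snd p h) H"
  have "translate_hull H k \<subseteq> ?\<Phi> ` ?K"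
    unfolding translate_hull_def[of H k]
  proof (rule closure_subset_compact_image)
    show "continuous_map (prod_topology (powertop_real H) (powertop_real H)) (powertop_real H) ?\<Phi>"
      by (intro continuous_map_pointwise_binary continuous_intros)
    show "compactin (prod_topology (powertop_real H) (powertop_real H)) ?K"
      using compactin_translate_hull[of f B H, OF f] by (simp add: compactin_Times compactin_PiE)
    show "(\<lambda>p. restrict (\<lambda>h. k (h + p)) H) ` H \<subseteq> ?\<Phi> ` ?K"
    proof
      fix w assume "w \<in> (\<lambda>p. restrict (\<lambda>h. k (h + p)) H) ` H"
      then obtain p where p: "p \<in> H" "w = restrict (\<lambda>h. k (h + p)) H" by blast
      have "w = ?\<Phi> (restrict (\<lambda>h. f (h + p)) H, restrict (\<lambda>h. k (h + p) - f (h + p)) H)"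
        using p(2) by (auto simp: fun_eq_iff)
      moreover have "restrict (\<lambda>h. k (h + p) - f (h + p)) H \<in> (\<Pi>\<^sub>E h\<in>H. {-\<epsilon>..\<epsilon>})"
        using near by (auto simp: abs_le_iff minus_le_iff[of \<epsilon>])
      ultimately show "w \<in> ?\<Phi> ` ?K" using translate_in_hull[OF p(1)] by blast
    qed
  qed
  then obtain p where p: "p \<in> ?K" "u = ?\<Phi> p" using u by blast
  show ?thesis
  proof (intro bexI[of _ "fst p"] ballI)
    show "fst p \<in> translate_hull H f" using p by auto
    fix h assume h: "h \<in> H"
    then have "snd p h \<in> {-\<epsilon>..\<epsilon>}" using p(1) by (auto simp: mem_Times_iff)
    then show "\<bar>u h - fst p h\<bar> \<le> \<epsilon>" using p(2) h by auto
  qed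
qed

lemma Veech_uniformly_closed: "uniformly_closed (Veech :: ('g::topological_group_add \<Rightarrow> real) set)"
  unfolding uniformly_closed_def
proof (intro allI impI)
  fix F and f :: "'g \<Rightarrow> real"
  assume F: "\<forall>n. F n \<in> Veech" and lim: "uniform_limit UNIV F f sequentially"
  show "f \<in> Veech"
  proof (rule VeechI)
    show "f \<in> RUC" using RUC_uniform_limit[OF _ lim] F VeechD(1) by blast
    fix H :: "'g set" assume H: "subgroup_set H" "countable H"
    show "separable_wrt (sup_dist H) (translate_hull H f)"
    proof (rule separable_wrt_transfer)
      fix \<epsilon> :: real assume "\<epsilon> > 0"
      then have "\<forall>\<^sub>F n in sequentially. \<forall>x. dist (F n x) (f x) < \<epsilon> / 2"
        using uniform_limitD[OF lim, of "\<epsilon> / 2"] by simp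
      then obtain n where n: "\<And>x. dist (F n x) (f x) < \<epsilon> / 2"
        by (auto simp: eventually_sequentially)
      then have near: "\<bar>f x - F n x\<bar> \<le> \<epsilon> / 2" for x
        using less_imp_le[OF n[of x]] by (simp add: dist_real_def abs_minus_commute)
      obtain B where B: "\<And>x. \<bar>F n x\<bar> \<le> B" using RUC_bounded VeechD(1) F by metis
      define R where "R u w \<longleftrightarrow> (\<forall>h\<in>H. \<bar>u h - w h\<bar> \<le> \<epsilon> / 2)" for u w :: "'g \<Rightarrow> real"
      have "\<exists>w\<in>translate_hull H (F n). R u w" if "u \<in> translate_hull H f" for u
        using translate_hull_perturb[OF B near that] by (simp add: R_def)
      moreover have "sup_dist H u u' \<le> sup_dist H w x + sup_dist H w' x + \<epsilon>"
        if wx: "w \<in> translate_hull H (F n)" "w' \<in> translate_hull H (F n)" "x \<in> translate_hull H (F n)"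
          and R: "R u w" "R u' w'" for u u' w w' x
      proof (rule sup_norm_le[OF subgroup_set_nonempty[OF H(1)]])
        fix h assume h: "h \<in> H"
        have "\<bar>w h - x h\<bar> \<le> sup_dist H w x" "\<bar>w' h - x h\<bar> \<le> sup_dist H w' x"
          using wx h by (auto intro: sup_dist_hull_le[OF B])
        moreover have "\<bar>u h - w h\<bar> \<le> \<epsilon> / 2" "\<bar>u' h - w' h\<bar> \<le> \<epsilon> / 2"
          using R h by (auto simp: R_def)
        ultimately show "\<bar>u h - u' h\<bar> \<le> sup_dist H w x + sup_dist H w' x + \<epsilon>" by linarith
      qed
      moreover have "separable_wrt (sup_dist H) (translate_hull H (F n))"
        using F H VeechD(2) by blast
      ultimately show "\<exists>(K :: ('g \<Rightarrow> real) set) d' R. separable_wrt d' K \<and>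
          (\<forall>s\<in>translate_hull H f. \<exists>a\<in>K. R s a) \<and>
          (\<forall>s\<in>translate_hull H f. \<forall>t\<in>translate_hull H f. \<forall>a\<in>K. \<forall>b\<in>K. \<forall>c\<in>K.
             R s a \<longrightarrow> R t b \<longrightarrow> sup_dist H s t \<le> d' a c + d' b c + \<epsilon>)"
        by (intro exI[of _ "translate_hull H (F n)"] exI[of _ "sup_dist H"] exI[of _ R]) blast
    qed
  qed
qed

text \<open>If, along \<open>\<sigma>\<close>, every translate of \<open>k\<close> on \<open>H\<close> is seen inside the hull of \<open>f\<close> over a countable subgroup
\<open>H'\<close>, then so is the entire hull of \<open>k\<close>, and pulling back along \<open>\<sigma>\<close> does not increase sup distances.
With \<open>\<sigma>\<close> a left translation this gives invariance of the Veech functions; with \<open>\<sigma>\<close> an inclusion it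
handles limits of right translates.\<close>

lemma separable_hull_from_larger_subgroup:
  fixes f k :: "'g::topological_group_add \<Rightarrow> real"
  assumes f: "f \<in> Veech" and H: "subgroup_set H" and H': "subgroup_set H'" "countable H'"
    and \<sigma>: "\<sigma> ` H \<subseteq> H'"
    and tr: "\<And>p. p \<in> H \<Longrightarrow> \<exists>w\<in>translate_hull H' f. \<forall>h\<in>H. k (h + p) = w (\<sigma> h)"
  shows "separable_wrt (sup_dist H) (translate_hull H k)"
proof -
  obtain B where B: "\<And>x. \<bar>f x\<bar> \<le> B" using RUC_bounded[OF VeechD(1)[OF f]] by blast
  let ?\<Phi> = "\<lambda>w. restrict (\<lambda>h. w (\<sigma> h)) H"
  have sub: "translate_hull H k \<subseteq> ?\<Phi> ` translate_hull H' f"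
    unfolding translate_hull_def[of H k]
  proof (rule closure_subset_compact_image[OF compactin_translate_hull[OF B]])
    show "continuous_map (powertop_real H') (powertop_real H) ?\<Phi>"
      unfolding continuous_map_componentwise
    proof (intro conjI ballI)
      fix h assume "h \<in> H"
      then show "continuous_map (powertop_real H') euclideanreal (\<lambda>w. ?\<Phi> w h)"
        using \<sigma> continuous_map_product_projection[of "\<sigma> h" H' "\<lambda>_. euclideanreal"] by auto
    qed auto
    show "(\<lambda>p. restrict (\<lambda>h. k (h + p)) H) ` H \<subseteq> ?\<Phi> ` translate_hull H' f"
    proof
      fix u assume "u \<in> (\<lambda>p. restrict (\<lambda>h. k (h + p)) H) ` H"
      then obtain p where p: "p \<in> H" "u = restrict (\<lambda>h. k (h + p)) H" by blast
      then obtain w where "w \<in> translate_hull H' f" "\<forall>h\<in>H. k (h + p) = w (\<sigma> h)" using tr by blast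
      then show "u \<in> ?\<Phi> ` translate_hull H' f"
        using p(2) by (intro image_eqI[of _ _ w]) (auto simp: fun_eq_iff)
    qed
  qed
  show ?thesis
  proof (rule separable_wrt_image[OF VeechD(2)[OF f H'] sub])
    fix a b c
    assume abc: "a \<in> translate_hull H' f" "b \<in> translate_hull H' f" "c \<in> translate_hull H' f"
    show "sup_dist H (?\<Phi> a) (?\<Phi> b) \<le> sup_dist H' a c + sup_dist H' b c"
    proof (rule sup_norm_le[OF subgroup_set_nonempty[OF H]])
      fix h assume h: "h \<in> H"
      then have "\<bar>a (\<sigma> h) - c (\<sigma> h)\<bar> \<le> sup_dist H' a c" "\<bar>b (\<sigma> h) - c (\<sigma> h)\<bar> \<le> sup_dist H' b c"
        using abc \<sigma> by (auto intro!: sup_dist_hull_le[OF B])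
      then show "\<bar>?\<Phi> a h - ?\<Phi> b h\<bar> \<le> sup_dist H' a c + sup_dist H' b c" using h by simp
    qed
  qed
qed

lemma Veech_left_invariant: "left_invariant (Veech :: ('g::topological_group_add \<Rightarrow> real) set)"
  unfolding left_invariant_def
proof (intro ballI allI)
  fix f :: "'g \<Rightarrow> real" and g assume f: "f \<in> Veech"
  show "left_translate g f \<in> Veech"
  proof (rule VeechI)
    show "left_translate g f \<in> RUC" using RUC_left_translate VeechD(1) f by blast
    fix H :: "'g set" assume H: "subgroup_set H" "countable H"
    then obtain H' where H': "subgroup_set H'" "countable H'" "insert g H \<subseteq> H'"
      using countable_subgroup_containing[of "insert g H"] by auto
    show "separable_wrt (sup_dist H) (translate_hull H (left_translate g f))"
    proof (rule separable_hull_from_larger_subgroup[OF f H(1) H'(1,2)])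
      show closed: "(\<lambda>h. g + h) ` H \<subseteq> H'" using H' by (auto simp: subgroup_set_def)
      fix p assume "p \<in> H"
      then show "\<exists>w\<in>translate_hull H' f. \<forall>h\<in>H. left_translate g f (h + p) = w (g + h)"
        using H' closed
        by (intro bexI[OF _ translate_in_hull[of p]]) (auto simp: left_translate_def add.assoc)
    qed
  qed
qed

lemma Veech_subalgebra: "RUC_subalgebra Veech"
  unfolding RUC_subalgebra_def using VeechD(1) Veech_const Veech_add Veech_mult by blast


section \<open>Limits of right translates\<close>

lemma translate_hull_right_translate:
  assumes w: "w \<in> translate_hull H f" and p: "p \<in> H" and H: "subgroup_set H"
  shows "restrict (\<lambda>h. w (h + p)) H \<in> translate_hull H f"
  unfolding in_translate_hull_iff
proof (intro conjI allI impI)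
  fix E and \<epsilon> :: real assume E: "finite E" "E \<subseteq> H" "\<epsilon> > 0"
  then have "finite ((\<lambda>h. h + p) ` E)" "(\<lambda>h. h + p) ` E \<subseteq> H"
    using p H by (auto simp: subgroup_set_def)
  then obtain q where q: "q \<in> H" "\<forall>h\<in>(\<lambda>h. h + p) ` E. \<bar>f (h + q) - w h\<bar> < \<epsilon>"
    using w E(3) unfolding in_translate_hull_iff by metis
  then show "\<exists>q\<in>H. \<forall>h\<in>E. \<bar>f (h + q) - restrict (\<lambda>h. w (h + p)) H h\<bar> < \<epsilon>"
    using E p H by (intro bexI[of _ "p + q"]) (auto simp: add.assoc subgroup_set_def)
qed simp

text \<open>Restriction to \<open>H\<close> maps the compact hull over \<open>H'\<close> onto a closed set containing all restricted
translates, so a limit of these on \<open>H\<close> extends to an element of the hull.\<close>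

lemma translate_hull_extension:
  assumes f: "\<And>x. \<bar>f x\<bar> \<le> B" and HH': "H \<subseteq> H'"
    and k: "\<And>E \<epsilon>. finite E \<Longrightarrow> E \<subseteq> H \<Longrightarrow> \<epsilon> > 0 \<Longrightarrow> \<exists>p\<in>H'. \<forall>h\<in>E. \<bar>f (h + p) - k h\<bar> < \<epsilon>"
  shows "\<exists>w\<in>translate_hull H' f. \<forall>h\<in>H. k h = w h"
proof -
  let ?S = "(\<lambda>p. restrict (\<lambda>h. f (h + p)) H) ` H'"
  have "?S \<subseteq> extensional H" by auto
  then have "restrict k H \<in> powertop_real H closure_of ?S"
  proof (subst in_powertop_closure_iff, safe)
    fix E and \<epsilon> :: real assume E: "finite E" "E \<subseteq> H" "\<epsilon> > 0"
    then obtain p where "p \<in> H'" "\<forall>h\<in>E. \<bar>f (h + p) - k h\<bar> < \<epsilon>" using k by blast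
    then show "\<exists>s\<in>?S. \<forall>i\<in>E. \<bar>s i - restrict k H i\<bar> < \<epsilon>"
      using E(2) by (intro bexI[of _ "restrict (\<lambda>h. f (h + p)) H"]) (auto simp: subset_iff)
  qed auto
  moreover have "powertop_real H closure_of ?S \<subseteq> (\<lambda>w. restrict w H) ` translate_hull H' f"
  proof (rule closure_subset_compact_image[OF compactin_translate_hull[OF f]])
    show "continuous_map (powertop_real H') (powertop_real H) (\<lambda>w. restrict w H)"
      unfolding continuous_map_componentwise
    proof (intro conjI ballI)
      fix h assume "h \<in> H"
      then show "continuous_map (powertop_real H') euclideanreal (\<lambda>w. restrict w H h)"
        using HH' continuous_map_product_projection[of h H' "\<lambda>_. euclideanreal"] by auto
    qed auto
    show "?S \<subseteq> (\<lambda>w. restrict w H) ` translate_hull H' f"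
    proof
      fix u assume "u \<in> ?S"
      then obtain p where p: "p \<in> H'" "u = restrict (\<lambda>h. f (h + p)) H" by blast
      then have "u = restrict (restrict (\<lambda>h. f (h + p)) H') H"
        using HH' by (auto simp: fun_eq_iff)
      then show "u \<in> (\<lambda>w. restrict w H) ` translate_hull H' f" using translate_in_hull[OF p(1)] by blast
    qed
  qed
  ultimately obtain w where "w \<in> translate_hull H' f" "restrict k H = restrict w H" by blast
  then show ?thesis by (metis restrict_apply')
qed

text \<open>The translations used to approximate \<open>k\<close> come from all of \<open>G\<close>, whereas the Veech property only speaks
of countable subgroups. On a countable \<open>H\<close>, however, countably many translations are enough, one for
each finite subset and each precision. Adjoining them to \<open>H\<close> gives a countable \<open>H'\<close> over which \<open>k\<close>
comes from a point \<open>w\<close> of the hull of \<open>f\<close>; the hull of \<open>k\<close> then arises from translates of \<open>w\<close>.\<close>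

lemma Veech_translate_hull:
  fixes f :: "'g::topological_group_add \<Rightarrow> real"
  assumes f: "f \<in> Veech" and k: "k \<in> translate_hull UNIV f"
  shows "k \<in> Veech"
proof (rule VeechI)
  show "k \<in> RUC" using translate_hull_subset_RUC VeechD(1) f k by blast
  fix H :: "'g set" assume H: "subgroup_set H" "countable H"
  obtain B where B: "\<And>x. \<bar>f x\<bar> \<le> B" using RUC_bounded[OF VeechD(1)[OF f]] by blast
  define I where "I = {E. finite E \<and> E \<subseteq> H} \<times> (UNIV :: nat set)"
  have "\<exists>p. \<forall>h\<in>fst i. \<bar>f (h + p) - k h\<bar> < 1 / real (Suc (snd i))" if "i \<in> I" for i
    using k that unfolding in_translate_hull_iff I_def
    by (metis (no_types, lifting) SigmaE fst_conv mem_Collect_eq of_nat_0_less_iff subset_UNIV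
        zero_less_Suc zero_less_divide_1_iff)
  then obtain p where p: "\<And>i. i \<in> I \<Longrightarrow> \<forall>h\<in>fst i. \<bar>f (h + p i) - k h\<bar> < 1 / real (Suc (snd i))"
    by metis
  have "countable (H \<union> p ` I)"
    using countable_Collect_finite_subset[OF H(2)] H(2) by (simp add: I_def)
  then obtain H' where H': "subgroup_set H'" "countable H'" "H \<union> p ` I \<subseteq> H'"
    by (rule countable_subgroup_containing)
  have "\<exists>w\<in>translate_hull H' f. \<forall>h\<in>H. k h = w h"
  proof (rule translate_hull_extension[OF B])
    fix E and \<epsilon> :: real assume E: "finite E" "E \<subseteq> H" and "\<epsilon> > 0"
    then obtain n where n: "1 / real (Suc n) < \<epsilon>" using nat_approx_posE by blast
    have i: "(E, n) \<in> I" using E by (simp add: I_def)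
    with p[OF i] n H' show "\<exists>q\<in>H'. \<forall>h\<in>E. \<bar>f (h + q) - k h\<bar> < \<epsilon>"
      by (intro bexI[of _ "p (E, n)"]) (fastforce, blast)
  qed (use H' in auto)
  then obtain w where w: "w \<in> translate_hull H' f" "\<forall>h\<in>H. k h = w h" by blast
  show "separable_wrt (sup_dist H) (translate_hull H k)"
  proof (rule separable_hull_from_larger_subgroup[OF f H(1) H'(1,2), where \<sigma> = "\<lambda>h. h"])
    show "(\<lambda>h. h) ` H \<subseteq> H'" using H' by auto
    fix q assume q: "q \<in> H"
    then have "restrict (\<lambda>h. w (h + q)) H' \<in> translate_hull H' f"
      using H' by (intro translate_hull_right_translate[OF w(1)]) auto
    moreover have "\<forall>h\<in>H. k (h + q) = restrict (\<lambda>h. w (h + q)) H' h"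
      using q w(2) H(1) H'(3) by (auto simp: subgroup_set_def)
    ultimately show "\<exists>w\<in>translate_hull H' f. \<forall>h\<in>H. k (h + q) = w h" by blast
  qed
qed

section \<open>Gelfand spaces and point-universality\<close>

lemma RUC_subalgebraD:
  assumes "RUC_subalgebra A"
  shows "f \<in> A \<Longrightarrow> f \<in> RUC" "(\<lambda>_. c) \<in> A"
    "f \<in> A \<Longrightarrow> k \<in> A \<Longrightarrow> (\<lambda>x. f x + k x) \<in> A" "f \<in> A \<Longrightarrow> k \<in> A \<Longrightarrow> (\<lambda>x. f x * k x) \<in> A"
    "f \<in> A \<Longrightarrow> (\<lambda>x. c * f x) \<in> A"
proof -
  show c: "(\<lambda>_. c) \<in> A" for c using assms by (simp add: RUC_subalgebra_def)
  show mult: "(\<lambda>x. f x * k x) \<in> A" if "f \<in> A" "k \<in> A" for f k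
    using assms that by (simp add: RUC_subalgebra_def)
  show "(\<lambda>x. c * f x) \<in> A" if "f \<in> A" using mult[OF c that] .
qed (use assms in \<open>auto simp: RUC_subalgebra_def\<close>)

lemma Gelfand_spaceD:
  assumes "\<phi> \<in> Gelfand_space A"
  shows "f \<in> A \<Longrightarrow> k \<in> A \<Longrightarrow> \<phi> (\<lambda>x. f x + k x) = \<phi> f + \<phi> k"
    "f \<in> A \<Longrightarrow> k \<in> A \<Longrightarrow> \<phi> (\<lambda>x. f x * k x) = \<phi> f * \<phi> k"
    "f \<in> A \<Longrightarrow> \<phi> (\<lambda>x. c * f x) = c * \<phi> f"
    "\<phi> \<in> extensional A"
  using assms by (simp_all add: Gelfand_space_def)

lemma Gelfand_space_const:
  assumes A: "RUC_subalgebra A" and \<phi>: "\<phi> \<in> Gelfand_space A"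
  shows "\<phi> (\<lambda>_. c) = c"
proof -
  obtain f where f: "f \<in> A" "\<phi> f \<noteq> 0" using \<phi> by (auto simp: Gelfand_space_def)
  have "\<phi> (\<lambda>x. f x * 1) = \<phi> f * \<phi> (\<lambda>_. 1)"
    by (rule Gelfand_spaceD(2)[OF \<phi> f(1) RUC_subalgebraD(2)[OF A]])
  then have "\<phi> (\<lambda>_. 1) = 1" using f(2) by simp
  moreover have "\<phi> (\<lambda>_. c * 1) = c * \<phi> (\<lambda>_. 1)"
    by (rule Gelfand_spaceD(3)[OF \<phi> RUC_subalgebraD(2)[OF A]])
  ultimately show ?thesis by simp
qed

text \<open>If \<open>q\<close> were bounded below by \<open>\<delta> > 0\<close>, it would be invertible in the algebra, which is impossible in the
kernel of a character. The inverse is reached by a geometric series: \<open>r = 1 - q/B\<close> takes values in an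
interval \<open>[0,c]\<close> with \<open>c < 1\<close>, so \<open>s = \<Sum> r\<^sup>i\<close> converges uniformly and satisfies \<open>s = 1 + r s\<close>; but \<open>\<phi>(r) = 1\<close>
makes this \<open>\<phi>(s) = 1 + \<phi>(s)\<close>.\<close>

lemma Gelfand_kernel_not_bounded_below:
  fixes A :: "('g::topological_group_add \<Rightarrow> real) set"
  assumes A: "RUC_subalgebra A" "uniformly_closed A" and \<phi>: "\<phi> \<in> Gelfand_space A"
    and q: "q \<in> A" "\<phi> q = 0" and "\<delta> > 0"
  shows "\<exists>g. q g < \<delta>"
proof (rule ccontr)
  assume "\<not> (\<exists>g. q g < \<delta>)"
  then have low: "\<delta> \<le> q g" for g by (simp add: not_less)
  obtain B where B: "\<And>x. \<bar>q x\<bar> \<le> B" using RUC_bounded RUC_subalgebraD(1)[OF A(1) q(1)] by blast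
  have "B > 0" using B[of 0] low[of 0] \<open>\<delta> > 0\<close> by linarith
  define r where "r g = 1 + (- 1 / B) * q g" for g
  define c where "c = 1 - \<delta> / B"
  have r: "0 \<le> r g" "r g \<le> c" for g
    using low[of g] B[of g] \<open>B > 0\<close> by (auto simp: r_def c_def field_simps abs_le_iff)
  have "c < 1" using \<open>B > 0\<close> \<open>\<delta> > 0\<close> by (simp add: c_def)
  have "c \<ge> 0" using r(1)[of 0] r(2)[of 0] by linarith
  note alg = RUC_subalgebraD[OF A(1)]
  have qc: "(\<lambda>g. (- 1 / B) * q g) \<in> A" by (rule alg(5)[OF q(1)])
  have rA: "r \<in> A" unfolding r_def using alg(3)[OF alg(2) qc] .
  have \<phi>r: "\<phi> r = 1"
    unfolding r_def Gelfand_spaceD(1)[OF \<phi> alg(2) qc] Gelfand_spaceD(3)[OF \<phi> q(1)] q(2)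
    by (simp add: Gelfand_space_const[OF A(1) \<phi>])
  define s where "s g = (\<Sum>i. r g ^ i)" for g
  have pow: "(\<lambda>g. r g ^ i) \<in> A" for i
  proof (induction i)
    case (Suc i) then show ?case using alg(4)[OF rA] by simp
  qed (simp add: alg(2))
  have part: "(\<lambda>g. \<Sum>i<n. r g ^ i) \<in> A" for n
  proof (induction n)
    case (Suc n) then show ?case using alg(3)[OF Suc pow[of n]] by simp
  qed (simp add: alg(2))
  have "uniform_limit UNIV (\<lambda>n g. \<Sum>i<n. r g ^ i) s sequentially"
    unfolding s_def
  proof (rule Weierstrass_m_test[where M = "\<lambda>i. c ^ i"])
    show "norm (r g ^ i) \<le> c ^ i" for i g using r[of g] by (simp add: power_mono)
    show "summable (\<lambda>i. c ^ i)" using \<open>c < 1\<close> \<open>c \<ge> 0\<close> by (simp add: summable_geometric)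
  qed
  moreover have "(\<forall>n. (\<lambda>g. \<Sum>i<n. r g ^ i) \<in> A) \<longrightarrow>
      uniform_limit UNIV (\<lambda>n g. \<Sum>i<n. r g ^ i) s sequentially \<longrightarrow> s \<in> A"
    using A(2) unfolding uniformly_closed_def by (elim allE)
  ultimately have sA: "s \<in> A" using part by simp
  have s: "s g = 1 + r g * s g" for g
  proof -
    have "norm (r g) < 1" using r[of g] \<open>c < 1\<close> by simp
    then show ?thesis by (simp add: s_def suminf_geometric field_simps)
  qed
  have "\<phi> s = \<phi> (\<lambda>g. 1 + r g * s g)" using s by presburger
  also have "\<dots> = 1 + \<phi> r * \<phi> s"
    using Gelfand_spaceD(1)[OF \<phi> alg(2) alg(4)[OF rA sA]] Gelfand_spaceD(2)[OF \<phi> rA sA]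
    by (simp add: Gelfand_space_const[OF A(1) \<phi>])
  finally show False using \<phi>r by simp
qed

text \<open>The function \<open>q = \<Sum>\<^sub>f (f - \<phi>(f))\<^sup>2\<close> lies in the kernel of \<open>\<phi>\<close>, so it takes a value below \<open>\<epsilon>\<^sup>2\<close>; a point where it
does is the required one.\<close>

lemma Gelfand_space_approx_evaluation:
  fixes A :: "('g::topological_group_add \<Rightarrow> real) set"
  assumes A: "RUC_subalgebra A" "uniformly_closed A" and \<phi>: "\<phi> \<in> Gelfand_space A"
    and E: "finite E" "E \<subseteq> A" and "\<epsilon> > 0"
  shows "\<exists>g. \<forall>f\<in>E. \<bar>f g - \<phi> f\<bar> < \<epsilon>"
proof -
  note alg = RUC_subalgebraD[OF A(1)]
  define q where "q E g = (\<Sum>f\<in>E. (f g - \<phi> f)\<^sup>2)" for E g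
  have "q E \<in> A \<and> \<phi> (q E) = 0" using E
  proof (induction E rule: finite_induct)
    case empty
    then show ?case using alg(2) Gelfand_space_const[OF A(1) \<phi>] by (simp add: q_def[abs_def])
  next
    case (insert f E)
    then have f: "f \<in> A" and qE: "q E \<in> A" "\<phi> (q E) = 0" by auto
    define d where "d g = f g + (- \<phi> f)" for g
    have d: "d \<in> A" unfolding d_def by (intro alg f)
    have "\<phi> d = \<phi> f + \<phi> (\<lambda>_. - \<phi> f)"
      unfolding d_def by (rule Gelfand_spaceD(1)[OF \<phi> f alg(2)])
    then have \<phi>d: "\<phi> d = 0" by (simp add: Gelfand_space_const[OF A(1) \<phi>])
    have eq: "q (insert f E) = (\<lambda>g. d g * d g + q E g)"
      using insert by (simp add: q_def d_def fun_eq_iff power2_eq_square)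
    show ?case
      unfolding eq
      using alg(3)[OF alg(4)[OF d d] qE(1)] Gelfand_spaceD(1)[OF \<phi> alg(4)[OF d d] qE(1)]
        Gelfand_spaceD(2)[OF \<phi> d d] \<phi>d qE(2) by simp
  qed
  then obtain g where g: "q E g < \<epsilon>\<^sup>2"
    using Gelfand_kernel_not_bounded_below[OF A \<phi>, of "q E" "\<epsilon>\<^sup>2"] \<open>\<epsilon> > 0\<close> by auto
  have "\<bar>f g - \<phi> f\<bar> < \<epsilon>" if "f \<in> E" for f
  proof -
    have "(f g - \<phi> f)\<^sup>2 \<le> q E g" unfolding q_def using that E(1) by (intro member_le_sum) auto
    with g have "(f g - \<phi> f)\<^sup>2 < \<epsilon>\<^sup>2" by linarith
    then show ?thesis using \<open>\<epsilon> > 0\<close> by (metis abs_le_square_iff abs_of_pos not_le)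
  qed
  then show ?thesis by blast
qed

lemma topspace_Gelfand_topology: "topspace (Gelfand_topology A) = Gelfand_space A"
  by (auto simp: Gelfand_topology_def Gelfand_space_def PiE_def)

lemma left_translate_simps:
  "left_translate g (\<lambda>x. f x + k x) = (\<lambda>x. left_translate g f x + left_translate g k x)"
  "left_translate g (\<lambda>x. f x * k x) = (\<lambda>x. left_translate g f x * left_translate g k x)"
  "left_translate g (\<lambda>x. c * f x) = (\<lambda>x. c * left_translate g f x)"
  by (simp_all add: left_translate_def)

lemma left_translate_left_translate:
  fixes f :: "'g::group_add \<Rightarrow> real"
  shows "left_translate h (left_translate g f) = left_translate (g + h) f"
  by (simp add: left_translate_def add.assoc)

text \<open>Evaluation at \<open>p\<close> gives the right translate of \<open>f\<close> by \<open>p\<close>; a general functional gives a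
  limit of such translates.\<close>

definition functional_shift :: "(('g \<Rightarrow> real) \<Rightarrow> real) \<Rightarrow> ('g::plus \<Rightarrow> real) \<Rightarrow> 'g \<Rightarrow> real" where
  "functional_shift \<phi> f = (\<lambda>g. \<phi> (left_translate g f))"

lemma functional_shift_in_translate_hull:
  fixes A :: "('g::topological_group_add \<Rightarrow> real) set"
  assumes A: "RUC_subalgebra A" "uniformly_closed A" "left_invariant A"
    and \<phi>: "\<phi> \<in> Gelfand_space A" and f: "f \<in> A"
  shows "functional_shift \<phi> f \<in> translate_hull UNIV f"
  unfolding in_translate_hull_iff
proof (intro conjI allI impI)
  fix E :: "'g set" and \<epsilon> :: real assume E: "finite E" "\<epsilon> > 0"
  have "\<exists>p. \<forall>k\<in>(\<lambda>g. left_translate g f) ` E. \<bar>k p - \<phi> k\<bar> < \<epsilon>"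
    using A(3) f E by (intro Gelfand_space_approx_evaluation[OF A(1,2) \<phi>]) (auto simp: left_invariant_def)
  then show "\<exists>p\<in>UNIV. \<forall>h\<in>E. \<bar>f (h + p) - functional_shift \<phi> f h\<bar> < \<epsilon>"
    by (auto simp: functional_shift_def left_translate_def)
qed simp

text \<open>Translating the base point gives all evaluations, so density of its orbit is again the approximation
of functionals by evaluations.\<close>

lemma Gelfand_act_eva_e_dense:
  fixes A :: "('g::topological_group_add \<Rightarrow> real) set"
  assumes A: "RUC_subalgebra A" "uniformly_closed A" "left_invariant A"
  shows "Gelfand_space A \<subseteq> Gelfand_topology A closure_of (range (\<lambda>g. Gelfand_act A g (eva_e A)))"
proof
  fix \<phi> assume \<phi>: "\<phi> \<in> Gelfand_space A"
  have ev: "Gelfand_act A g (eva_e A) = restrict (\<lambda>f. f g) A" for g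
    using A(3) by (auto simp: Gelfand_act_def eva_e_def left_invariant_def left_translate_def
        fun_eq_iff restrict_def)
  have "restrict (\<lambda>f. f g) A \<in> Gelfand_space A" for g
  proof -
    have "\<exists>f\<in>A. f g \<noteq> 0" using RUC_subalgebraD(2)[OF A(1), of 1] by (intro bexI[of _ "\<lambda>_. 1"]) auto
    then show ?thesis unfolding Gelfand_space_def using RUC_subalgebraD(3-5)[OF A(1)] by auto
  qed
  then have sub: "range (\<lambda>g. restrict (\<lambda>f. f g) A) \<subseteq> Gelfand_space A" by blast
  have "\<phi> \<in> powertop_real A closure_of (range (\<lambda>g. restrict (\<lambda>f. f g) A))"
  proof (subst in_powertop_closure_iff)
    show "\<phi> \<in> extensional A \<and> (\<forall>E \<epsilon>. finite E \<longrightarrow> E \<subseteq> A \<longrightarrow> \<epsilon> > 0 \<longrightarrow>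
        (\<exists>s\<in>range (\<lambda>g. restrict (\<lambda>f. f g) A). \<forall>i\<in>E. \<bar>s i - \<phi> i\<bar> < \<epsilon>))"
    proof (intro conjI allI impI)
      fix E and \<epsilon> :: real assume E: "finite E" "E \<subseteq> A" "\<epsilon> > 0"
      obtain g where "\<forall>f\<in>E. \<bar>f g - \<phi> f\<bar> < \<epsilon>"
        using Gelfand_space_approx_evaluation[OF A(1,2) \<phi> E] by blast
      then show "\<exists>s\<in>range (\<lambda>g. restrict (\<lambda>f. f g) A). \<forall>i\<in>E. \<bar>s i - \<phi> i\<bar> < \<epsilon>"
        using E(2) by (intro bexI[of _ "restrict (\<lambda>f. f g) A"]) auto
    qed (rule Gelfand_spaceD(4)[OF \<phi>])
  qed auto
  then show "\<phi> \<in> Gelfand_topology A closure_of (range (\<lambda>g. Gelfand_act A g (eva_e A)))"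
    unfolding Gelfand_topology_def closure_of_subtopology ev using \<phi> sub by (simp add: inf.absorb2)
qed

text \<open>For \<open>x\<close> in the Gelfand space, \<open>T = functional_shift x\<close> maps \<open>A\<close> into itself by the assumption on hulls.
It is an algebra endomorphism commuting with left translations, so its dual \<open>\<pi>(\<phi>) = \<phi> \<circ> T\<close> is a
continuous equivariant self-map of the Gelfand space. It sends \<open>eva_e\<close> to \<open>x\<close>, hence by density its
values lie in the orbit closure of \<open>x\<close>.\<close>

lemma point_universal_if_translate_hull_closed:
  fixes A :: "('g::topological_group_add \<Rightarrow> real) set"
  assumes A: "RUC_subalgebra A" "uniformly_closed A" "left_invariant A"
    and hull: "\<And>f k. f \<in> A \<Longrightarrow> k \<in> translate_hull UNIV f \<Longrightarrow> k \<in> A"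
  shows "point_universal A"
  unfolding point_universal_def
proof
  fix x assume x: "x \<in> Gelfand_space A"
  let ?T = "functional_shift x" and ?X = "Gelfand_topology A"
  have T: "?T f \<in> A" if "f \<in> A" for f
    using functional_shift_in_translate_hull[OF A x that] hull that by blast
  have inv: "left_translate g f \<in> A" if "f \<in> A" for f g
    using A(3) that by (simp add: left_invariant_def)
  note alg = RUC_subalgebraD[OF A(1)]
  define \<pi> where "\<pi> \<phi> = restrict (\<lambda>f. \<phi> (?T f)) A" for \<phi> :: "('g \<Rightarrow> real) \<Rightarrow> real"
  have Tsimps: "?T (\<lambda>x. f x + k x) = (\<lambda>g. ?T f g + ?T k g)" "?T (\<lambda>x. f x * k x) = (\<lambda>g. ?T f g * ?T k g)"
    "?T (\<lambda>x. c * f x) = (\<lambda>g. c * ?T f g)" if "f \<in> A" "k \<in> A" for f k c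
    by (rule ext, simp only: functional_shift_def left_translate_simps(1-2) Gelfand_spaceD(1-2)[OF x inv inv] that,
        rule ext, simp only: functional_shift_def left_translate_simps(1-2) Gelfand_spaceD(1-2)[OF x inv inv] that,
        rule ext, simp only: functional_shift_def left_translate_simps(3) Gelfand_spaceD(3)[OF x inv] that)
  have Tconst: "?T (\<lambda>_. 1) = (\<lambda>_. 1)"
    using Gelfand_space_const[OF A(1) x] by (simp add: functional_shift_def left_translate_def)
  have \<pi>_Gelfand: "\<pi> \<phi> \<in> Gelfand_space A" if \<phi>: "\<phi> \<in> Gelfand_space A" for \<phi>
  proof -
    have "\<pi> \<phi> (\<lambda>_. 1) \<noteq> 0"
      using Gelfand_space_const[OF A(1) \<phi>] Tconst alg(2) by (simp add: \<pi>_def)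
    then have "\<exists>f\<in>A. \<pi> \<phi> f \<noteq> 0" using alg(2) by blast
    moreover have "\<pi> \<phi> (\<lambda>x. f x + k x) = \<pi> \<phi> f + \<pi> \<phi> k" "\<pi> \<phi> (\<lambda>x. f x * k x) = \<pi> \<phi> f * \<pi> \<phi> k"
      "\<pi> \<phi> (\<lambda>x. c * f x) = c * \<pi> \<phi> f" if "f \<in> A" "k \<in> A" for f k c
      using Gelfand_spaceD(1-3)[OF \<phi>] T that alg(3-5) by (simp_all add: \<pi>_def Tsimps)
    moreover have "\<pi> \<phi> \<in> extensional A" by (simp add: \<pi>_def)
    ultimately show ?thesis unfolding Gelfand_space_def by blast
  qed
  have Tl: "left_translate g (?T f) = ?T (left_translate g f)" for f g
    unfolding functional_shift_def left_translate_left_translate by (simp add: left_translate_def)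
  have equi: "\<pi> (Gelfand_act A g \<phi>) = Gelfand_act A g (\<pi> \<phi>)" for g \<phi>
    using T inv by (auto simp: \<pi>_def Gelfand_act_def Tl fun_eq_iff restrict_def)
  have base: "\<pi> (eva_e A) = x"
  proof
    fix f show "\<pi> (eva_e A) f = x f"
      using T Gelfand_spaceD(4)[OF x]
      by (cases "f \<in> A") (auto simp: \<pi>_def eva_e_def functional_shift_def left_translate_def extensional_def)
  qed
  have cont: "continuous_map ?X ?X \<pi>"
    unfolding Gelfand_topology_def
  proof (rule continuous_map_into_subtopology)
    show "continuous_map (subtopology (powertop_real A) (Gelfand_space A)) (powertop_real A) \<pi>"
      unfolding continuous_map_componentwise
    proof (intro conjI ballI)
      fix f assume "f \<in> A"
      then show "continuous_map (subtopology (powertop_real A) (Gelfand_space A)) euclideanreal (\<lambda>\<phi>. \<pi> \<phi> f)"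
        using continuous_map_from_subtopology[OF continuous_map_product_projection[OF T]]
        by (simp add: \<pi>_def)
    qed (auto simp: \<pi>_def)
    show "\<pi> \<in> topspace (subtopology (powertop_real A) (Gelfand_space A)) \<rightarrow> Gelfand_space A"
      using \<pi>_Gelfand by auto
  qed
  have "\<pi> ` range (\<lambda>g. Gelfand_act A g (eva_e A)) = range (\<lambda>g. Gelfand_act A g x)"
    by (simp add: image_image equi base)
  then have "\<pi> ` Gelfand_space A \<subseteq> ?X closure_of (range (\<lambda>g. Gelfand_act A g x))"
    using continuous_map_image_closure_subset[OF cont, of "range (\<lambda>g. Gelfand_act A g (eva_e A))"]
      Gelfand_act_eva_e_dense[OF A] by auto
  then have "continuous_map ?X (subtopology ?X (?X closure_of (range (\<lambda>g. Gelfand_act A g x)))) \<pi>"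
    by (intro continuous_map_into_subtopology[OF cont]) (auto simp: topspace_Gelfand_topology)
  with equi base show "\<exists>\<pi>. continuous_map ?X (subtopology ?X (?X closure_of (range (\<lambda>g. Gelfand_act A g x)))) \<pi> \<and>
      (\<forall>g. \<forall>\<phi>\<in>Gelfand_space A. \<pi> (Gelfand_act A g \<phi>) = Gelfand_act A g (\<pi> \<phi>)) \<and> \<pi> (eva_e A) = x"
    by blast
qed


section \<open>Asplund functions\<close>

lemma compact_G_systemD:
  assumes "compact_G_system Y act"
  shows "compact_space Y" "continuous_map Y Y (act g)"
    "y \<in> topspace Y \<Longrightarrow> act (g + h) y = act g (act h y)"
proof -
  have "continuous_map Y (prod_topology euclidean Y) (\<lambda>y. (g, y))"
    by (intro continuous_map_pairedI) auto
  moreover have "continuous_map (prod_topology euclidean Y) Y (\<lambda>(g, y). act g y)"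
    using assms by (simp add: compact_G_system_def)
  ultimately have "continuous_map Y Y ((\<lambda>(g, y). act g y) \<circ> (\<lambda>y. (g, y)))"
    by (rule continuous_map_compose)
  then show "continuous_map Y Y (act g)" by (simp add: o_def)
qed (use assms in \<open>auto simp: compact_G_system_def\<close>)

lemma compact_G_system_act_closed:
  "compact_G_system Y act \<Longrightarrow> y \<in> topspace Y \<Longrightarrow> act g y \<in> topspace Y"
  using compact_G_systemD(2) by (fastforce simp: continuous_map_def)

lemma compact_space_function_bounded:
  assumes "compact_space Y" "continuous_map Y euclideanreal F"
  obtains B where "\<And>y. y \<in> topspace Y \<Longrightarrow> \<bar>F y\<bar> \<le> B"
proof -
  have "compactin euclideanreal (F ` topspace Y)"
    using assms(1) by (intro image_compactin[OF _ assms(2)]) (simp add: compact_space_def)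
  then have "bounded (F ` topspace Y)" by (simp add: compact_imp_bounded)
  with that show thesis by (auto simp: bounded_iff)
qed

text \<open>The map taking \<open>y\<close> to \<open>h \<mapsto> F(hy)\<close> on \<open>H\<close> carries \<open>Y\<close> onto a compact set containing the translates of \<open>f\<close>,
and it is isometric from \<open>orbit_pseudometric act H F\<close> to the sup norm.\<close>

lemma Asplund_subset_Veech: "Asp_on TYPE('y) \<subseteq> (Veech :: ('g::topological_group_add \<Rightarrow> real) set)"
proof
  fix f :: "'g \<Rightarrow> real" assume "f \<in> Asp_on TYPE('y)"
  then obtain Y :: "'y topology" and act :: "'g \<Rightarrow> 'y \<Rightarrow> 'y" and y0 F where
    f: "f \<in> RUC" and sys: "compact_G_system Y act" and y0: "dense_orbit Y act y0"
    and F: "Asplund_function Y act F" and fF: "\<And>g. f g = F (act g y0)"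
    unfolding Asp_on_def by blast
  have cF: "continuous_map Y euclideanreal F" using F by (simp add: Asplund_function_def)
  have y0Y: "y0 \<in> topspace Y" using y0 by (simp add: dense_orbit_def)
  obtain B where B: "\<And>y. y \<in> topspace Y \<Longrightarrow> \<bar>F y\<bar> \<le> B"
    using compact_space_function_bounded[OF compact_G_systemD(1)[OF sys] cF] by blast
  note act = compact_G_system_act_closed[OF sys]
  show "f \<in> Veech"
  proof (rule VeechI[OF f])
    fix H :: "'g set" assume H: "subgroup_set H" "countable H"
    let ?\<Phi> = "\<lambda>y. restrict (\<lambda>h. F (act h y)) H"
    have sub: "translate_hull H f \<subseteq> ?\<Phi> ` topspace Y"
      unfolding translate_hull_def
    proof (rule closure_subset_compact_image)
      show "compactin Y (topspace Y)" using compact_G_systemD(1)[OF sys] by (simp add: compact_space_def)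
      show "continuous_map Y (powertop_real H) ?\<Phi>"
        unfolding continuous_map_componentwise
      proof (intro conjI ballI)
        fix h assume "h \<in> H"
        then show "continuous_map Y euclideanreal (\<lambda>y. ?\<Phi> y h)"
          using continuous_map_compose[OF compact_G_systemD(2)[OF sys] cF] by (simp add: o_def)
      qed auto
      show "(\<lambda>p. restrict (\<lambda>h. f (h + p)) H) ` H \<subseteq> ?\<Phi> ` topspace Y"
      proof (rule image_subsetI)
        fix p
        show "restrict (\<lambda>h. f (h + p)) H \<in> ?\<Phi> ` topspace Y"
          using act[OF y0Y, of p]
          by (intro image_eqI[of _ _ "act p y0"]) (simp_all add: fF compact_G_systemD(3)[OF sys y0Y])
      qed
    qed
    have sep: "separable_wrt (orbit_pseudometric act H F) (topspace Y)"
      using F H by (simp add: Asplund_function_def)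
    show "separable_wrt (sup_dist H) (translate_hull H f)"
    proof (rule separable_wrt_image[OF sep sub])
      fix a b c assume abc: "a \<in> topspace Y" "b \<in> topspace Y" "c \<in> topspace Y"
      show "sup_dist H (?\<Phi> a) (?\<Phi> b) \<le> orbit_pseudometric act H F a c + orbit_pseudometric act H F b c"
      proof (rule sup_norm_le[OF subgroup_set_nonempty[OF H(1)]])
        fix h assume h: "h \<in> H"
        have "\<bar>F (act h y) - F (act h c)\<bar> \<le> orbit_pseudometric act H F y c" if "y \<in> topspace Y" for y
          unfolding orbit_pseudometric_def
          using B act that abc(3) h by (intro abs_diff_le_sup_dist[where c = B]) auto
        from this[OF abc(1)] this[OF abc(2)] h
        show "\<bar>?\<Phi> a h - ?\<Phi> b h\<bar> \<le> orbit_pseudometric act H F a c + orbit_pseudometric act H F b c"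
          by simp
      qed
    qed
  qed
qed

lemma s_Asplund_imp_Asplund_function:
  fixes act :: "'g::topological_group_add \<Rightarrow> 'y \<Rightarrow> 'y"
  assumes sys: "compact_G_system Y act" and F: "s_Asplund_function Y act F"
  shows "Asplund_function Y act F"
  unfolding Asplund_function_def
proof (intro conjI allI impI)
  show cF: "continuous_map Y euclideanreal F" using F by (simp add: s_Asplund_function_def)
  obtain B where B: "\<And>y. y \<in> topspace Y \<Longrightarrow> \<bar>F y\<bar> \<le> B"
    using compact_space_function_bounded[OF compact_G_systemD(1)[OF sys] cF] by blast
  fix H :: "'g set" assume H: "subgroup_set H \<and> countable H"
  have sep: "separable_wrt (orbit_pseudometric act UNIV F) (topspace Y)"
    using F by (simp add: s_Asplund_function_def)
  show "separable_wrt (orbit_pseudometric act H F) (topspace Y)"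
  proof (rule separable_wrt_image[OF sep, of _ "\<lambda>y. y"])
    fix a b c assume abc: "a \<in> topspace Y" "b \<in> topspace Y" "c \<in> topspace Y"
    show "orbit_pseudometric act H F a b \<le> orbit_pseudometric act UNIV F a c + orbit_pseudometric act UNIV F b c"
      unfolding orbit_pseudometric_def[of act H]
    proof (rule sup_norm_le)
      show "H \<noteq> {}" using H subgroup_set_nonempty by blast
      fix h
      have "\<bar>F (act h y) - F (act h c)\<bar> \<le> orbit_pseudometric act UNIV F y c" if "y \<in> topspace Y" for y
        unfolding orbit_pseudometric_def using B compact_G_system_act_closed[OF sys] that abc(3)
        by (intro abs_diff_le_sup_dist[where c = B]) auto
      from this[OF abc(1)] this[OF abc(2)]
      show "\<bar>F (act h a) - F (act h b)\<bar>
          \<le> orbit_pseudometric act UNIV F a c + orbit_pseudometric act UNIV F b c"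
        by linarith
    qed
  qed simp
qed

lemma Asp_s_subset_Asp: "Asp_s \<subseteq> Asp"
  unfolding Asp_s_def Asp_s_on_def Asp_def Asp_on_def using s_Asplund_imp_Asplund_function by blast

definition hull_topology :: "('g::topological_group_add \<Rightarrow> real) \<Rightarrow> ('g \<Rightarrow> real) topology" where
  "hull_topology f = subtopology (powertop_real UNIV) (translate_hull UNIV f)"

text \<open>Multiplying the argument on the right gives a left action, which on the orbit of \<open>f\<close> is
  left translation of the parameter.\<close>

definition right_shift :: "'g::plus \<Rightarrow> ('g \<Rightarrow> real) \<Rightarrow> 'g \<Rightarrow> real" where
  "right_shift g w = (\<lambda>x. w (x + g))"

lemma subgroup_set_UNIV: "subgroup_set UNIV"
  by (simp add: subgroup_set_def)

lemma topspace_hull_topology: "topspace (hull_topology f) = translate_hull UNIV f"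
  by (simp add: hull_topology_def)

lemma right_shift_in_hull: "w \<in> translate_hull UNIV f \<Longrightarrow> right_shift g w \<in> translate_hull UNIV f"
  using translate_hull_right_translate[of w UNIV f g] by (simp add: right_shift_def subgroup_set_UNIV restrict_def)

lemma openin_hull_topology_nhd:
  assumes "w0 \<in> translate_hull UNIV f" "e > 0"
  shows "openin (hull_topology f) {w \<in> translate_hull UNIV f. \<bar>w a - w0 a\<bar> < e}"
proof -
  have "continuous_map (hull_topology f) euclideanreal (\<lambda>w. w a)"
    unfolding hull_topology_def
    by (intro continuous_map_from_subtopology continuous_map_product_projection) simp
  from openin_continuous_map_preimage[OF this, of "ball (w0 a) e"]
  show ?thesis by (simp add: topspace_hull_topology dist_real_def abs_minus_commute)
qed

text \<open>Joint continuity combines equicontinuity of the hull in the group variable with pointwise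
convergence in the function variable.\<close>

lemma continuous_right_shift_evaluation:
  assumes f: "f \<in> RUC"
  shows "continuous_map (prod_topology euclidean (hull_topology f)) euclideanreal (\<lambda>(g, w). w (a + g))"
  unfolding continuous_map_def
proof (intro conjI allI impI)
  fix U :: "real set" assume U: "openin euclidean U"
  let ?P = "prod_topology euclidean (hull_topology f)"
  let ?Q = "{p \<in> topspace ?P. (case p of (g, w) \<Rightarrow> w (a + g)) \<in> U}"
  show "openin ?P ?Q"
    unfolding openin_prod_topology_alt
  proof (intro allI impI)
    fix b w0 assume "(b, w0) \<in> ?Q"
    then have w0: "w0 \<in> translate_hull UNIV f" "w0 (a + b) \<in> U" by (auto simp: topspace_hull_topology)
    then obtain e where e: "e > 0" "ball (w0 (a + b)) e \<subseteq> U"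
      using U by (auto elim: openE)
    have "\<forall>\<^sub>F g in nhds b. \<forall>w\<in>translate_hull UNIV f. \<bar>w (a + g) - w (a + b)\<bar> < e / 2"
      by (rule translate_hull_equicontinuous[OF f]) (use e in simp)
    then obtain V where V: "open V" "b \<in> V"
      "\<And>g w. g \<in> V \<Longrightarrow> w \<in> translate_hull UNIV f \<Longrightarrow> \<bar>w (a + g) - w (a + b)\<bar> < e / 2"
      unfolding eventually_nhds by blast
    let ?W = "{w \<in> translate_hull UNIV f. \<bar>w (a + b) - w0 (a + b)\<bar> < e / 2}"
    have "w (a + g) \<in> U" if "g \<in> V" "w \<in> ?W" for g w
    proof -
      have "\<bar>w (a + g) - w (a + b)\<bar> < e / 2" "\<bar>w (a + b) - w0 (a + b)\<bar> < e / 2"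
        using V(3) that by auto
      then have "\<bar>w (a + g) - w0 (a + b)\<bar> < e" by linarith
      then show ?thesis using e(2) by (auto simp: dist_real_def abs_minus_commute)
    qed
    then have "V \<times> ?W \<subseteq> ?Q" by (auto simp: topspace_hull_topology)
    moreover have "openin (hull_topology f) ?W" 
      by (rule openin_hull_topology_nhd) (use w0 e in auto)
    moreover have "w0 \<in> ?W" using w0(1) e(1) by simp
    ultimately show "\<exists>V W. openin euclidean V \<and> openin (hull_topology f) W \<and> b \<in> V \<and> w0 \<in> W \<and> V \<times> W \<subseteq> ?Q"
      using V(1,2) by (intro exI[of _ V] exI[of _ ?W]) auto
  qed
qed auto

lemma compact_G_system_hull:
  assumes f: "f \<in> RUC"
  shows "compact_G_system (hull_topology f) right_shift"
  unfolding compact_G_system_def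
proof (intro conjI ballI allI)
  obtain B where B: "\<And>x. \<bar>f x\<bar> \<le> B" using RUC_bounded[OF f] by blast
  show "compact_space (hull_topology f)"
    unfolding hull_topology_def by (rule compact_space_subtopology[OF compactin_translate_hull[OF B]])
  show "Hausdorff_space (hull_topology f)"
    unfolding hull_topology_def
    by (intro Hausdorff_space_subtopology) (simp add: Hausdorff_space_product_topology)
  show "continuous_map (prod_topology euclidean (hull_topology f)) (hull_topology f) (\<lambda>(g, w). right_shift g w)"
    unfolding hull_topology_def[of f]
  proof (rule continuous_map_into_subtopology, fold hull_topology_def)
    show "continuous_map (prod_topology euclidean (hull_topology f)) (powertop_real UNIV) (\<lambda>(g, w). right_shift g w)"
      unfolding continuous_map_componentwise
      using continuous_right_shift_evaluation[OF f] by (simp add: right_shift_def case_prod_unfold)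
    show "(\<lambda>(g, w). right_shift g w) \<in> topspace (prod_topology euclidean (hull_topology f)) \<rightarrow> translate_hull UNIV f"
      using right_shift_in_hull by (auto simp: topspace_hull_topology)
  qed
qed (simp_all add: right_shift_def add.assoc)

lemma dense_orbit_hull: "dense_orbit (hull_topology f) right_shift f"
proof -
  have sub: "range (\<lambda>g. right_shift g f) \<subseteq> translate_hull UNIV f"
    using translate_in_hull[of _ UNIV f] by (auto simp: right_shift_def restrict_def)
  have "translate_hull UNIV f = powertop_real UNIV closure_of (range (\<lambda>g. right_shift g f))"
    by (simp add: translate_hull_def right_shift_def restrict_def)
  moreover have "f \<in> translate_hull UNIV f"
    using translate_in_hull[of 0 UNIV f] by (simp add: restrict_def)
  ultimately show ?thesis
    using sub by (simp add: dense_orbit_def hull_topology_def closure_of_subtopology inf.absorb2)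
qed

text \<open>The translations approximating \<open>w\<close> on a finite set may be taken in \<open>H\<close>, since \<open>f(hp)\<close> depends
continuously on \<open>p\<close>.\<close>

lemma restrict_hull_dense_subgroup:
  assumes f: "f \<in> RUC" and dense: "closure H = UNIV" and w: "w \<in> translate_hull UNIV f"
  shows "restrict w H \<in> translate_hull H f"
  unfolding in_translate_hull_iff
proof (intro conjI allI impI)
  fix E and \<epsilon> :: real assume E: "finite E" "E \<subseteq> H" "\<epsilon> > 0"
  then obtain p where p: "\<forall>h\<in>E. \<bar>f (h + p) - w h\<bar> < \<epsilon> / 2"
    using w unfolding in_translate_hull_iff by (metis half_gt_zero subset_UNIV)
  have fh: "f \<in> translate_hull UNIV f" using translate_in_hull[of 0 UNIV f] by (simp add: restrict_def)
  have "\<forall>\<^sub>F g in nhds p. \<forall>h\<in>E. \<bar>f (h + g) - f (h + p)\<bar> < \<epsilon> / 2"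
  proof (rule eventually_ball_finite[OF E(1)], intro ballI)
    fix h
    have "\<forall>\<^sub>F g in nhds p. \<forall>w\<in>translate_hull UNIV f. \<bar>w (h + g) - w (h + p)\<bar> < \<epsilon> / 2"
      by (rule translate_hull_equicontinuous[OF f]) (use E in simp)
    then show "\<forall>\<^sub>F g in nhds p. \<bar>f (h + g) - f (h + p)\<bar> < \<epsilon> / 2"
      by (rule eventually_mono) (use fh in blast)
  qed
  then obtain V where V: "open V" "p \<in> V" "\<And>g h. g \<in> V \<Longrightarrow> h \<in> E \<Longrightarrow> \<bar>f (h + g) - f (h + p)\<bar> < \<epsilon> / 2"
    unfolding eventually_nhds by blast
  obtain q where q: "q \<in> H" "q \<in> V"
    using dense V(1,2) by (metis UNIV_I closure_iff_nhds_not_empty disjoint_iff subset_refl)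
  have "\<bar>f (h + q) - restrict w H h\<bar> < \<epsilon>" if h: "h \<in> E" for h
  proof -
    have "\<bar>f (h + q) - f (h + p)\<bar> < \<epsilon> / 2" "\<bar>f (h + p) - w h\<bar> < \<epsilon> / 2" using V(3) q h p by auto
    moreover have "restrict w H h = w h" using h E(2) by auto
    ultimately show ?thesis by linarith
  qed
  then show "\<exists>p\<in>H. \<forall>h\<in>E. \<bar>f (h + p) - restrict w H h\<bar> < \<epsilon>" using q(1) by blast
qed simp

lemma hull_difference_bound_dense:
  assumes f: "f \<in> RUC" and dense: "closure H = UNIV"
    and u: "u \<in> translate_hull UNIV f" and w: "w \<in> translate_hull UNIV f"
    and c: "\<And>h. h \<in> H \<Longrightarrow> \<bar>u h - w h\<bar> \<le> c"
  shows "\<bar>u g - w g\<bar> \<le> c"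
proof (rule field_le_epsilon)
  fix e :: real assume "e > 0"
  have "\<forall>\<^sub>F x in nhds g. \<forall>w\<in>translate_hull UNIV f. \<bar>w (0 + x) - w (0 + g)\<bar> < e / 2"
    by (rule translate_hull_equicontinuous[OF f]) (use \<open>e > 0\<close> in simp)
  then obtain V where V: "open V" "g \<in> V"
    "\<And>x w. x \<in> V \<Longrightarrow> w \<in> translate_hull UNIV f \<Longrightarrow> \<bar>w x - w g\<bar> < e / 2"
    unfolding eventually_nhds by auto
  obtain h where h: "h \<in> H" "h \<in> V"
    using dense V(1,2) by (metis UNIV_I closure_iff_nhds_not_empty disjoint_iff subset_refl)
  show "\<bar>u g - w g\<bar> \<le> c + e" using V(3)[OF h(2) u] V(3)[OF h(2) w] c[OF h(1)] by linarith
qed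

text \<open>The witness is the hull of \<open>f\<close> over \<open>G\<close> with base point \<open>f\<close> and evaluation at the identity. There
the orbit pseudometric is the sup distance over \<open>G\<close>, which by continuity is the sup distance over a
countable dense subgroup, where the Veech property applies.\<close>

lemma Veech_subset_Asp_s:
  assumes "separable_space (euclidean :: 'g::topological_group_add topology)"
  shows "(Veech :: ('g \<Rightarrow> real) set) \<subseteq> Asp_s"
proof
  fix f :: "'g \<Rightarrow> real" assume f: "f \<in> Veech"
  note fR = VeechD(1)[OF f]
  obtain S :: "'g set" where S: "countable S" "closure S = UNIV"
    using assms by (auto simp: separable_space_def)
  obtain H where H: "subgroup_set H" "countable H" "S \<subseteq> H"
    using countable_subgroup_containing[OF S(1)] by blast
  have dense: "closure H = UNIV" using closure_mono[OF H(3)] S(2) by auto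
  obtain B where B: "\<And>x. \<bar>f x\<bar> \<le> B" using RUC_bounded[OF fR] by blast
  define F :: "('g \<Rightarrow> real) \<Rightarrow> real" where "F w = w 0" for w
  have Fs: "F (right_shift g w) = w g" for g w by (simp add: F_def right_shift_def)
  have "separable_wrt (sup_dist UNIV) (translate_hull UNIV f)"
  proof (rule separable_wrt_transfer)
    fix \<epsilon> :: real assume "\<epsilon> > 0"
    define R where "R w a \<longleftrightarrow> a = restrict w H" for w a :: "'g \<Rightarrow> real"
    have "sup_dist UNIV u w \<le> sup_dist H a c + sup_dist H b c + \<epsilon>"
      if uw: "u \<in> translate_hull UNIV f" "w \<in> translate_hull UNIV f"
        and abc: "a \<in> translate_hull H f" "b \<in> translate_hull H f" "c \<in> translate_hull H f"
        and R: "R u a" "R w b" for u w a b c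
    proof (rule sup_norm_le)
      fix g
      show "\<bar>u g - w g\<bar> \<le> sup_dist H a c + sup_dist H b c + \<epsilon>"
      proof (rule hull_difference_bound_dense[OF fR dense uw])
        fix h assume h: "h \<in> H"
        have "\<bar>a h - c h\<bar> \<le> sup_dist H a c" "\<bar>b h - c h\<bar> \<le> sup_dist H b c"
          using abc h by (auto intro: sup_dist_hull_le[OF B])
        moreover have "a h = u h" "b h = w h" using R h by (simp_all add: R_def)
        ultimately show "\<bar>u h - w h\<bar> \<le> sup_dist H a c + sup_dist H b c + \<epsilon>"
          using \<open>\<epsilon> > 0\<close> by linarith
      qed
    qed simp
    moreover have "\<exists>a\<in>translate_hull H f. R w a" if "w \<in> translate_hull UNIV f" for w
      using restrict_hull_dense_subgroup[OF fR dense that] by (auto simp: R_def)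
    ultimately show "\<exists>(K :: ('g \<Rightarrow> real) set) d' R. separable_wrt d' K \<and>
        (\<forall>s\<in>translate_hull UNIV f. \<exists>a\<in>K. R s a) \<and>
        (\<forall>s\<in>translate_hull UNIV f. \<forall>t\<in>translate_hull UNIV f. \<forall>a\<in>K. \<forall>b\<in>K. \<forall>c\<in>K.
           R s a \<longrightarrow> R t b \<longrightarrow> sup_dist UNIV s t \<le> d' a c + d' b c + \<epsilon>)"
      using VeechD(2)[OF f H(1,2)]
      by (intro exI[of _ "translate_hull H f"] exI[of _ "sup_dist H"] exI[of _ R]) blast
  qed
  moreover have "continuous_map (hull_topology f) euclideanreal F"
    unfolding hull_topology_def F_def
    by (intro continuous_map_from_subtopology continuous_map_product_projection) simp
  ultimately have "s_Asplund_function (hull_topology f) right_shift F"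
    by (simp add: s_Asplund_function_def orbit_pseudometric_def[abs_def] Fs topspace_hull_topology)
  then have "f \<in> Asp_s_on TYPE('g \<Rightarrow> real)"
    unfolding Asp_s_on_def using fR compact_G_system_hull[OF fR] dense_orbit_hull[of f] Fs[symmetric]
    by (smt (verit) mem_Collect_eq)
  then show "f \<in> Asp_s" using Asp_s_on_subset_Asp_s by blast
qed


section \<open>Veech functions and Asplund functions\<close>

theorem theorem8p2:
  shows "(RUC_subalgebra (Veech :: ('g::topological_group_add \<Rightarrow> real) set) \<and>
            uniformly_closed (Veech :: ('g \<Rightarrow> real) set) \<and>
            left_invariant (Veech :: ('g \<Rightarrow> real) set)) \<and>
         point_universal (Veech :: ('g \<Rightarrow> real) set) \<and>
         (Asp :: ('g \<Rightarrow> real) set) \<subseteq> Veech \<and>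
         (separable_space (euclidean :: 'g topology) \<longrightarrow>
            (Veech :: ('g \<Rightarrow> real) set) = Asp \<and> (Asp :: ('g \<Rightarrow> real) set) = Asp_s)"
proof (intro conjI impI)
  show pu: "point_universal (Veech :: ('g \<Rightarrow> real) set)"
    by (rule point_universal_if_translate_hull_closed[OF Veech_subalgebra Veech_uniformly_closed
          Veech_left_invariant Veech_translate_hull])
  show AV: "(Asp :: ('g \<Rightarrow> real) set) \<subseteq> Veech"
    unfolding Asp_def by (rule Asplund_subset_Veech)
  assume sep: "separable_space (euclidean :: 'g topology)"
  show "(Veech :: ('g \<Rightarrow> real) set) = Asp" "(Asp :: ('g \<Rightarrow> real) set) = Asp_s"
    using AV Veech_subset_Asp_s[OF sep] Asp_s_subset_Asp by blast+
qed (rule Veech_subalgebra Veech_uniformly_closed Veech_left_invariant)+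

end
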